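(* Let $K$ be a field, and let $I_1\subseteq R_1=K[x_1,\dots,x_n]$ and $I_2\subseteq R_2=K[y_1,\dots,y_m]$ be two proper graded radical ideals. Let $R=R_1\otimes_K R_2=K[x_1,\dots,x_n,y_1,\dots,y_m]$ and $I_1+I_2:=I_1R+I_2R$. Suppose that $I_1+I_2$ is a radical ideal of $R$ with $\mathrm{Ass}(I_1+I_2)=\{P_1+P_2\mid P_1\in\mathrm{Ass}(I_1),\ P_2\in \mathrm{Ass}(I_2)\}$, where $P_1+P_2:=P_1R+P_2R$. Then $$\mathrm{v}(I_1+I_2)=\mathrm{v}(I_1)+\mathrm{v}(I_2).$$
   Context: All polynomial rings carry the standard grading. For a proper graded ideal $I$ of a standard graded polynomial ring $R=\bigoplus_{d\ge 0}R_d$ over $K$, $\mathrm{Ass}(I)$ denotes the set of associated primes of $R/I$, and the $\mathrm{v}$-number of $I$ is $\mathrm{v}(I)=\min\{d\ge 0\mid \exists f\in R_d \text{ and } \mathfrak p\in \mathrm{Ass}(I)\text{ with }(I:f)=\mathfrak p\}$. *)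

theory Defs
  imports "HOL-Algebra.Algebra" "HOL-Library.Poly_Mapping"
begin

text \<open>
  A monomial is a finitely supported exponent vector of type \<^typ>\<open>'v \<Rightarrow>\<^sub>0 nat\<close>, and a polynomial is
  a finitely supported map from monomials to coefficients. Multiplication in
  \<^theory>\<open>HOL-Library.Poly_Mapping\<close> is convolution, i.e. multiplication of polynomials.
\<close>

type_synonym ('v, 'k) mpoly = "('v \<Rightarrow>\<^sub>0 nat) \<Rightarrow>\<^sub>0 'k"

text \<open>
  The polynomial ring \<open>K[V]\<close> in a set \<open>V\<close> of indeterminates, with \<open>K\<close> the type \<open>'k\<close>.
  If \<open>V \<subseteq> W\<close> then \<open>K[V]\<close> is a subring of \<open>K[W]\<close>, so extending an ideal to a larger
  polynomial ring needs no embedding map.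
\<close>

definition mpoly_ring :: "'v set \<Rightarrow> ('v, 'k::field) mpoly ring" where
  "mpoly_ring V = \<lparr>carrier = {p. \<forall>m\<in>Poly_Mapping.keys p. Poly_Mapping.keys m \<subseteq> V},
     monoid.mult = (*), monoid.one = 1, ring.zero = 0, ring.add = (+)\<rparr>"

definition mono_deg :: "('v \<Rightarrow>\<^sub>0 nat) \<Rightarrow> nat" where
  "mono_deg m = (\<Sum>x\<in>Poly_Mapping.keys m. Poly_Mapping.lookup m x)"

definition graded_piece :: "'v set \<Rightarrow> nat \<Rightarrow> ('v, 'k::field) mpoly set" where
  "graded_piece V d =
     {p \<in> carrier (mpoly_ring V). \<forall>m\<in>Poly_Mapping.keys p. mono_deg m = d}"

definition hom_component :: "nat \<Rightarrow> ('v, 'k::field) mpoly \<Rightarrow> ('v, 'k) mpoly" where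
  "hom_component d p =
     (\<Sum>m | m \<in> Poly_Mapping.keys p \<and> mono_deg m = d.
        Poly_Mapping.single m (Poly_Mapping.lookup p m))"

definition graded_ideal :: "'v set \<Rightarrow> ('v, 'k::field) mpoly set \<Rightarrow> bool" where
  "graded_ideal V I \<longleftrightarrow>
     ideal I (mpoly_ring V) \<and> (\<forall>p\<in>I. \<forall>d. hom_component d p \<in> I)"

definition radical_of :: "('a, 'b) ring_scheme \<Rightarrow> 'a set \<Rightarrow> 'a set" where
  "radical_of R I = {a \<in> carrier R. \<exists>n::nat. n \<ge> 1 \<and> a [^]\<^bsub>R\<^esub> n \<in> I}"

definition radical_ideal :: "('a, 'b) ring_scheme \<Rightarrow> 'a set \<Rightarrow> bool" where
  "radical_ideal R I \<longleftrightarrow> ideal I R \<and> radical_of R I = I"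

definition colon :: "('a, 'b) ring_scheme \<Rightarrow> 'a set \<Rightarrow> 'a \<Rightarrow> 'a set" where
  "colon R I f = {r \<in> carrier R. r \<otimes>\<^bsub>R\<^esub> f \<in> I}"

text \<open>
  The associated primes of the \<open>R\<close>-module \<open>R/I\<close>: the prime ideals of \<open>R\<close> that are annihilators of
  an element of \<open>R/I\<close>. An element \<open>r\<close> of \<open>R\<close> acts on \<open>R/I\<close> as multiplication by its class.
\<close>

definition ass_primes :: "('a, 'b) ring_scheme \<Rightarrow> 'a set \<Rightarrow> 'a set set" where
  "ass_primes R I =
     {P. primeideal P R \<and>
         (\<exists>u\<in>carrier (R Quot I).
            P = {r \<in> carrier R. (I +>\<^bsub>R\<^esub> r) \<otimes>\<^bsub>R Quot I\<^esub> u = \<zero>\<^bsub>R Quot I\<^esub>})}"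

text \<open>
  The minimum is taken over a set that is nonempty whenever \<open>V\<close> is finite and \<open>I\<close> is a proper graded
  ideal of \<open>K[V]\<close>.
\<close>

definition v_number :: "'v set \<Rightarrow> ('v, 'k::field) mpoly set \<Rightarrow> nat" where
  "v_number V I =
     (LEAST d. \<exists>f\<in>graded_piece V d. \<exists>P\<in>ass_primes (mpoly_ring V) I.
        colon (mpoly_ring V) I f = P)"

text \<open>\<open>I R + J R\<close>, for ideals \<open>I\<close> and \<open>J\<close> of subrings of \<open>R\<close>.\<close>

definition ext_sum :: "('a, 'b) ring_scheme \<Rightarrow> 'a set \<Rightarrow> 'a set \<Rightarrow> 'a set" where
  "ext_sum R I J = (Idl\<^bsub>R\<^esub> I) <+>\<^bsub>R\<^esub> (Idl\<^bsub>R\<^esub> J)"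

end

theory Submission
  imports Defs
begin

text \<open>
  Write \<open>A = K[V]\<close>, \<open>B = K[W]\<close>, \<open>R = K[V \<union> W] = A \<otimes> B\<close> and \<open>S = I1 R + I2 R\<close>. A homogeneous \<open>f\<close>
  of least degree whose colon is an associated prime is called optimal below; by definition its degree
  is the v-number. Associated primes are the colons that are prime (\<open>ass_primes_iff_colon\<close>).

  Both inequalities rest on linear algebra over the field \<open>K\<close>, namely on two facts about
  \<open>R/S = A/I1 \<otimes> B/I2\<close>. If \<open>a\<^sub>1, \<dots>, a\<^sub>n \<in> A\<close> are linearly independent modulo \<open>I1\<close> and
  \<open>\<Sum> a\<^sub>i b\<^sub>i \<in> S\<close>, then every \<open>b\<^sub>i\<close> lies in \<open>I2\<close> (\<open>sum_ideal_coeff_mem\<close>): a functional on \<open>A\<close> that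
  kills \<open>I1\<close> and all \<open>a\<^sub>j\<close> but \<open>a\<^sub>i\<close> extends to a \<open>B\<close>-linear map \<open>R \<rightarrow> B\<close> that sends \<open>S\<close> into \<open>I2\<close>.
  And each element of \<open>R\<close> is modulo \<open>S\<close> a sum \<open>\<Sum> a\<^sub>i b\<^sub>i\<close> whose \<open>a\<^sub>i\<close> and \<open>b\<^sub>i\<close> are independent modulo
  \<open>I1\<close> and \<open>I2\<close> (\<open>independent_representation\<close>): a shortest sum has this property.

  For \<open>v(S) \<le> v(I1) + v(I2)\<close>, multiply optimal \<open>f1\<close> and \<open>f2\<close>: one has
  \<open>(S : f1 f2) = (I1 : f1) R + (I2 : f2) R\<close> (\<open>colon_prod_eq_sum_ideal\<close>), which is an associated prime
  of \<open>S\<close> by the assumption on \<open>Ass(S)\<close>.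

  For the converse, let \<open>f\<close> be optimal for \<open>S\<close>, so that \<open>(S : f) = P1 R + P2 R\<close> with \<open>P1\<close> and \<open>P2\<close>
  associated to \<open>I1\<close> and \<open>I2\<close>. Represent \<open>f\<close> as \<open>\<Sum> a\<^sub>i b\<^sub>i\<close> as above. From \<open>P1 f \<subseteq> S\<close> and independence
  follows \<open>P1 a\<^sub>i \<subseteq> I1\<close>, and likewise \<open>P2 b\<^sub>i \<subseteq> I2\<close>; this passes to the homogeneous components of
  \<open>a\<^sub>i\<close> and \<open>b\<^sub>i\<close>. As \<open>f \<notin> S\<close>, some product \<open>g1 g2\<close> of such components has the degree of \<open>f\<close> and is
  outside \<open>S\<close>, so \<open>g1 \<notin> I1\<close> and \<open>g2 \<notin> I2\<close> (\<open>homogeneous_factors_of_colon\<close>). Because \<open>I1\<close> and \<open>I2\<close>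
  are radical, this forces \<open>(I1 : g1) = P1\<close> and \<open>(I2 : g2) = P2\<close> (\<open>colon_eq_of_radical\<close>).

  A v-number is defined as a least element, so the argument also depends on the existence of some
  homogeneous \<open>f\<close> with prime colon (\<open>exists_homogeneous_prime_colon\<close>): a maximal colon of a
  homogeneous element outside the ideal is prime, and maximal colons exist by Hilbert's basis
  theorem, in the form that ideals of \<open>K[V]\<close> have no infinite strictly ascending chain.
\<close>

section \<open>Polynomial rings and their ideals\<close>

abbreviation Pol :: "'v set \<Rightarrow> ('v, 'k::field) mpoly set" where
  "Pol V \<equiv> carrier (mpoly_ring V)"

lemma mpoly_ring_simps [simp]:
  "a \<otimes>\<^bsub>mpoly_ring V\<^esub> b = a * b"
  "a \<oplus>\<^bsub>mpoly_ring V\<^esub> b = a + b"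
  "\<one>\<^bsub>mpoly_ring V\<^esub> = 1"
  "\<zero>\<^bsub>mpoly_ring V\<^esub> = 0"
  by (simp_all add: mpoly_ring_def)

lemma Pol_iff: "p \<in> Pol V \<longleftrightarrow> (\<forall>m\<in>Poly_Mapping.keys p. Poly_Mapping.keys m \<subseteq> V)"
  by (simp add: mpoly_ring_def)

lemma keys_add_monomial:
  fixes m n :: "'v \<Rightarrow>\<^sub>0 nat"
  shows "Poly_Mapping.keys (m + n) = Poly_Mapping.keys m \<union> Poly_Mapping.keys n"
  by (auto simp: in_keys_iff lookup_add)

lemma Pol_zero [simp]: "0 \<in> Pol V"
  by (simp add: Pol_iff)

lemma Pol_single [simp]: "Poly_Mapping.keys m \<subseteq> V \<Longrightarrow> Poly_Mapping.single m c \<in> Pol V"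
  by (simp add: Pol_iff)

lemma Pol_one [simp]: "1 \<in> Pol V"
  by (simp add: Pol_iff)

lemma Pol_add: "p \<in> Pol V \<Longrightarrow> q \<in> Pol V \<Longrightarrow> p + q \<in> Pol V"
  using Poly_Mapping.keys_add[of p q] by (fastforce simp: Pol_iff)

lemma Pol_uminus: "p \<in> Pol V \<Longrightarrow> - p \<in> Pol V"
  by (simp add: Pol_iff in_keys_iff)

lemma Pol_mult: "p \<in> Pol V \<Longrightarrow> q \<in> Pol V \<Longrightarrow> p * q \<in> Pol V"
  using keys_mult[of p q] by (fastforce simp: Pol_iff keys_add_monomial)

lemma Pol_mono: "V \<subseteq> W \<Longrightarrow> p \<in> Pol V \<Longrightarrow> p \<in> Pol W"
  by (auto simp: Pol_iff)

lemma Pol_sum: "(\<And>i. i \<in> F \<Longrightarrow> p i \<in> Pol V) \<Longrightarrow> (\<Sum>i\<in>F. p i) \<in> Pol V"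
  by (induction F rule: infinite_finite_induct) (simp_all add: Pol_add)

lemma cring_mpoly_ring: "cring (mpoly_ring V)"
proof (rule cringI)
  show "abelian_group (mpoly_ring V)"
  proof (rule abelian_groupI)
    show "\<exists>y\<in>Pol V. y \<oplus>\<^bsub>mpoly_ring V\<^esub> x = \<zero>\<^bsub>mpoly_ring V\<^esub>" if "x \<in> Pol V" for x
      using that
      by (intro bexI[of _ "- x"]) (simp_all add: Pol_uminus)
  qed (simp_all add: Pol_add ac_simps)
  show "Group.comm_monoid (mpoly_ring V)"
    by (rule comm_monoidI) (simp_all add: Pol_mult ac_simps)
qed (simp add: distrib_right)

lemma nat_pow_mpoly_ring [simp]: "p [^]\<^bsub>mpoly_ring V\<^esub> (n::nat) = p ^ n"
proof -
  interpret cring "mpoly_ring V" by (rule cring_mpoly_ring)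
  show ?thesis by (induction n) (simp_all add: mult.commute)
qed

lemma ideal_mpoly_ring_iff:
  fixes I :: "('v, 'k::field) mpoly set"
  shows "ideal I (mpoly_ring V) \<longleftrightarrow>
     I \<subseteq> Pol V \<and> 0 \<in> I \<and> (\<forall>p\<in>I. \<forall>q\<in>I. p + q \<in> I) \<and> (\<forall>r\<in>Pol V. \<forall>p\<in>I. r * p \<in> I)"
  (is "_ \<longleftrightarrow> ?R")
proof
  interpret cring "mpoly_ring V :: ('v, 'k) mpoly ring" by (rule cring_mpoly_ring)
  {
    assume "ideal I (mpoly_ring V)"
    then interpret ideal I "mpoly_ring V" .
    show ?R
      using a_subset zero_closed a_closed I_l_closed additive_subgroup.zero_closed[OF is_additive_subgroup]
      by auto
  }
  assume R: ?R
  have inv: "\<ominus>\<^bsub>mpoly_ring V\<^esub> p = - p" if "p \<in> Pol V" for p :: "('v, 'k) mpoly"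
    by (rule minus_equality) (simp_all add: that Pol_uminus)
  show "ideal I (mpoly_ring V)"
  proof (rule idealI)
    show "subgroup I (add_monoid (mpoly_ring V))"
    proof (rule add.subgroupI)
      fix p assume p: "p \<in> I"
      have "(- 1) * p \<in> I" using R p Pol_uminus[OF Pol_one] by blast
      with inv[of p] R p show "\<ominus>\<^bsub>mpoly_ring V\<^esub> p \<in> I" by auto
    qed (use R in auto)
  next
    fix p r :: "('v, 'k) mpoly" assume "p \<in> I" "r \<in> Pol V"
    with R show "r \<otimes>\<^bsub>mpoly_ring V\<^esub> p \<in> I" "p \<otimes>\<^bsub>mpoly_ring V\<^esub> r \<in> I"
      by (simp_all add: mult.commute[of p])
  qed (rule ring_axioms)
qed

lemma ideal_mpoly_ringD:
  assumes "ideal I (mpoly_ring V)"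
  shows "\<And>p. p \<in> I \<Longrightarrow> p \<in> Pol V" "0 \<in> I"
    "\<And>p q. p \<in> I \<Longrightarrow> q \<in> I \<Longrightarrow> p + q \<in> I"
    "\<And>p r. p \<in> I \<Longrightarrow> r \<in> Pol V \<Longrightarrow> r * p \<in> I"
    "\<And>p r. p \<in> I \<Longrightarrow> r \<in> Pol V \<Longrightarrow> p * r \<in> I"
proof -
  show l: "r * p \<in> I" if "p \<in> I" "r \<in> Pol V" for p r
    using assms that unfolding ideal_mpoly_ring_iff by blast
  show "p * r \<in> I" if "p \<in> I" "r \<in> Pol V" for p r
    using l[OF that] by (simp add: mult.commute)
qed (use assms in \<open>auto simp: ideal_mpoly_ring_iff\<close>)

lemma ideal_mpoly_ring_sum:
  "ideal I (mpoly_ring V) \<Longrightarrow> (\<And>i. i \<in> F \<Longrightarrow> p i \<in> I) \<Longrightarrow> (\<Sum>i\<in>F. p i) \<in> I"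
  by (induction F rule: infinite_finite_induct) (simp_all add: ideal_mpoly_ringD)

lemma ideal_mpoly_ring_uminus:
  "ideal I (mpoly_ring V) \<Longrightarrow> p \<in> I \<Longrightarrow> - p \<in> I"
  using ideal_mpoly_ringD(4)[of I V p "- 1"] by (simp add: Pol_uminus)

lemma ideal_mpoly_ring_diff:
  "ideal I (mpoly_ring V) \<Longrightarrow> p \<in> I \<Longrightarrow> q \<in> I \<Longrightarrow> p - q \<in> I"
  using ideal_mpoly_ringD(3)[of I V p "- q"] ideal_mpoly_ring_uminus by fastforce

lemma ideal_colon:
  assumes I: "ideal I (mpoly_ring V)" and f: "f \<in> Pol V"
  shows "ideal (colon (mpoly_ring V) I f) (mpoly_ring V)"
  using ideal_mpoly_ringD[OF I] f
  by (auto simp: ideal_mpoly_ring_iff colon_def Pol_add Pol_mult distrib_right mult.assoc)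

lemma (in cring) quotient_mult_eq_zero_iff:
  assumes I: "ideal I R" and rf: "r \<in> carrier R" "f \<in> carrier R"
  shows "(I +> r) \<otimes>\<^bsub>R Quot I\<^esub> (I +> f) = \<zero>\<^bsub>R Quot I\<^esub> \<longleftrightarrow> r \<otimes> f \<in> I"
proof -
  interpret ideal I R by (rule I)
  have "(I +> r) \<otimes>\<^bsub>R Quot I\<^esub> (I +> f) = I +> (r \<otimes> f)"
    using rf by (simp add: FactRing_def rcoset_mult_add)
  then show ?thesis
    using rf a_rcos_const a_rcos_self[of "r \<otimes> f"] by (auto simp: FactRing_def)
qed

text \<open>
  An element of \<open>R/I\<close> is a coset \<open>I + f\<close>, and \<open>r\<close> annihilates it iff \<open>r f \<in> I\<close>.
\<close>

lemma (in cring) ass_primes_iff_colon: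
  assumes I: "ideal I R"
  shows "P \<in> ass_primes R I \<longleftrightarrow> primeideal P R \<and> (\<exists>f\<in>carrier R. P = colon R I f)"
proof -
  have "carrier (R Quot I) = (\<lambda>f. I +> f) ` carrier R"
    by (auto simp: FactRing_def A_RCOSETS_def')
  moreover have "{r \<in> carrier R. (I +> r) \<otimes>\<^bsub>R Quot I\<^esub> (I +> f) = \<zero>\<^bsub>R Quot I\<^esub>} = colon R I f"
    if "f \<in> carrier R" for f
    using quotient_mult_eq_zero_iff[OF I _ that] by (auto simp: colon_def)
  ultimately show ?thesis by (auto simp: ass_primes_def)
qed

text \<open>
  For disjoint \<open>V\<close> and \<open>W\<close>, restriction to \<open>V\<close> and to \<open>W\<close> splits a monomial of \<open>K[V \<union> W]\<close> into its two
  tensor factors.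
\<close>

definition restrict_monomial :: "'v set \<Rightarrow> ('v \<Rightarrow>\<^sub>0 nat) \<Rightarrow> ('v \<Rightarrow>\<^sub>0 nat)" where
  "restrict_monomial V m = Abs_poly_mapping (\<lambda>x. Poly_Mapping.lookup m x when x \<in> V)"

lemma lookup_restrict_monomial:
  "Poly_Mapping.lookup (restrict_monomial V m) x = (Poly_Mapping.lookup m x when x \<in> V)"
  unfolding restrict_monomial_def
  by (subst lookup_Abs_poly_mapping) (auto intro: finite_subset[OF _ finite_keys[of m]] simp: in_keys_iff when_def)

lemma keys_restrict_monomial:
  "Poly_Mapping.keys (restrict_monomial V m) = Poly_Mapping.keys m \<inter> V"
  by (auto simp: in_keys_iff lookup_restrict_monomial when_def split: if_splits)

lemma restrict_monomial_add:
  "restrict_monomial V (m + n) = restrict_monomial V m + restrict_monomial V n"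
  by (rule poly_mapping_eqI) (simp add: lookup_restrict_monomial lookup_add when_add_distrib)

lemma restrict_monomial_id: "Poly_Mapping.keys m \<subseteq> V \<Longrightarrow> restrict_monomial V m = m"
  by (rule poly_mapping_eqI) (auto simp: lookup_restrict_monomial in_keys_iff when_def)

lemma restrict_monomial_zero: "Poly_Mapping.keys m \<inter> V = {} \<Longrightarrow> restrict_monomial V m = 0"
  by (rule poly_mapping_eqI) (auto simp: lookup_restrict_monomial in_keys_iff when_def)

lemma restrict_monomial_split:
  assumes "V \<inter> W = {}" and "Poly_Mapping.keys m \<subseteq> V \<union> W"
  shows "restrict_monomial V m + restrict_monomial W m = m"
  using assms
  by (intro poly_mapping_eqI) (auto simp: lookup_restrict_monomial lookup_add in_keys_iff when_def)

lemma mpoly_eq_sum_single: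
  "p = (\<Sum>m\<in>Poly_Mapping.keys p. Poly_Mapping.single m (Poly_Mapping.lookup p m))"
  by (rule poly_mapping_eqI)
    (auto simp: lookup_sum lookup_single when_def in_keys_iff sum.delta' cong: if_cong)

section \<open>Sums of ideals in disjoint sets of indeterminates\<close>

text \<open>
  The image of \<open>I \<otimes> K[W] + K[V] \<otimes> J\<close> in \<open>K[V] \<otimes> K[W] = K[V \<union> W]\<close>, which is the ideal that \<open>I\<close> and
  \<open>J\<close> generate together (\<open>ext_sum_eq_sum_ideal\<close>). In this form additive statements about it need to be
  checked only for products of one polynomial from each of the two rings.
\<close>

inductive_set sum_ideal ::
    "'v set \<Rightarrow> 'v set \<Rightarrow> ('v, 'k::field) mpoly set \<Rightarrow> ('v, 'k) mpoly set \<Rightarrow> ('v, 'k) mpoly set"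
  for V W :: "'v set" and I J :: "('v, 'k) mpoly set" where
  zero: "0 \<in> sum_ideal V W I J"
| step: "a \<in> Pol V \<Longrightarrow> b \<in> Pol W \<Longrightarrow> a \<in> I \<or> b \<in> J \<Longrightarrow> p \<in> sum_ideal V W I J \<Longrightarrow>
    a * b + p \<in> sum_ideal V W I J"

lemma sum_ideal_prod:
  "a \<in> Pol V \<Longrightarrow> b \<in> Pol W \<Longrightarrow> a \<in> I \<or> b \<in> J \<Longrightarrow> a * b \<in> sum_ideal V W I J"
  using sum_ideal.step[OF _ _ _ sum_ideal.zero] by fastforce

lemma sum_ideal_add:
  "p \<in> sum_ideal V W I J \<Longrightarrow> q \<in> sum_ideal V W I J \<Longrightarrow> p + q \<in> sum_ideal V W I J"
  by (induction rule: sum_ideal.induct) (simp_all add: add.assoc sum_ideal.step)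

lemma sum_ideal_sum:
  "(\<And>i. i \<in> F \<Longrightarrow> p i \<in> sum_ideal V W I J) \<Longrightarrow> (\<Sum>i\<in>F. p i) \<in> sum_ideal V W I J"
  by (induction F rule: infinite_finite_induct) (simp_all add: sum_ideal_add sum_ideal.zero)

lemma sum_ideal_commute: "sum_ideal V W I J = sum_ideal W V J I"
proof -
  have "p \<in> sum_ideal W V J I" if "p \<in> sum_ideal V W I J"
    for p V W and I J :: "('v, 'k::field) mpoly set"
    using that
  proof (induction rule: sum_ideal.induct)
    case (step a b p)
    then have "b * a + p \<in> sum_ideal W V J I" by (intro sum_ideal.step) auto
    then show ?case by (simp add: mult.commute)
  qed (rule sum_ideal.zero)
  then show ?thesis by blast
qed

lemma sum_ideal_mult:
  assumes I: "ideal I (mpoly_ring V)" and J: "ideal J (mpoly_ring W)"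
    and a: "a \<in> Pol V" and b: "b \<in> Pol W" and p: "p \<in> sum_ideal V W I J"
  shows "(a * b) * p \<in> sum_ideal V W I J"
  using p
proof (induction rule: sum_ideal.induct)
  case (step a' b' p)
  have "(a * a') * (b * b') + (a * b) * p \<in> sum_ideal V W I J"
    using step a b ideal_mpoly_ringD(4)[OF I] ideal_mpoly_ringD(4)[OF J]
    by (intro sum_ideal.step) (auto simp: Pol_mult)
  then show ?case by (simp add: algebra_simps)
qed (simp add: sum_ideal.zero)

text \<open>
  A polynomial in \<open>V \<union> W\<close> is a sum of tensors \<open>a b\<close>; the decomposition into monomials gives one.
\<close>

lemma Pol_Un_eq_sum_products:
  assumes "V \<inter> W = {}" and q: "q \<in> Pol (V \<union> W)"
  shows "q = (\<Sum>m\<in>Poly_Mapping.keys q.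
    Poly_Mapping.single (restrict_monomial V m) (Poly_Mapping.lookup q m) *
    Poly_Mapping.single (restrict_monomial W m) 1)"
  by (subst mpoly_eq_sum_single[of q], rule sum.cong)
    (use assms in \<open>auto simp: mult_single restrict_monomial_split Pol_iff\<close>)

lemma ideal_sum_ideal:
  fixes I J :: "('v, 'k::field) mpoly set"
  assumes "V \<inter> W = {}" and I: "ideal I (mpoly_ring V)" and J: "ideal J (mpoly_ring W)"
  shows "ideal (sum_ideal V W I J) (mpoly_ring (V \<union> W))"
  unfolding ideal_mpoly_ring_iff
proof (intro conjI ballI)
  show "sum_ideal V W I J \<subseteq> Pol (V \<union> W)"
  proof
    fix p assume "p \<in> sum_ideal V W I J"
    then show "p \<in> Pol (V \<union> W)"
    proof (induction rule: sum_ideal.induct)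
      case (step a b p)
      then show ?case
        using Pol_mono[of V "V \<union> W" a] Pol_mono[of W "V \<union> W" b] by (simp add: Pol_add Pol_mult)
    qed simp
  qed
  fix q p :: "('v, 'k) mpoly" assume q: "q \<in> Pol (V \<union> W)" and p: "p \<in> sum_ideal V W I J"
  show "q * p \<in> sum_ideal V W I J"
    by (subst Pol_Un_eq_sum_products[OF assms(1) q], subst sum_distrib_right)
      (intro sum_ideal_sum sum_ideal_mult I J p, simp_all add: keys_restrict_monomial)
qed (simp_all add: sum_ideal.zero sum_ideal_add)

text \<open>
  One inclusion holds because \<open>sum_ideal\<close> is an ideal of \<open>K[V \<union> W]\<close> containing \<open>I\<close> and \<open>J\<close>, the other
  because a generator \<open>a b\<close> lies in the extension of \<open>I\<close> or in that of \<open>J\<close>.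
\<close>

lemma ext_sum_eq_sum_ideal:
  assumes disj: "V \<inter> W = {}" and I: "ideal I (mpoly_ring V)" and J: "ideal J (mpoly_ring W)"
  shows "ext_sum (mpoly_ring (V \<union> W)) I J = sum_ideal V W I J"
proof -
  let ?R = "mpoly_ring (V \<union> W)"
  interpret cring ?R by (rule cring_mpoly_ring)
  note IV = ideal_mpoly_ringD[OF I] and JW = ideal_mpoly_ringD[OF J]
  have sub: "I \<subseteq> carrier ?R" "J \<subseteq> carrier ?R"
    using IV(1) JW(1) Pol_mono[of V "V \<union> W"] Pol_mono[of W "V \<union> W"] by auto
  note SI = ideal_sum_ideal[OF assms]
  have idl: "ideal (Idl\<^bsub>?R\<^esub> I) ?R" "ideal (Idl\<^bsub>?R\<^esub> J) ?R"
    using genideal_ideal sub by auto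
  have ext: "ext_sum ?R I J = {x + y | x y. x \<in> Idl\<^bsub>?R\<^esub> I \<and> y \<in> Idl\<^bsub>?R\<^esub> J}"
    by (auto simp: ext_sum_def set_add_def')
  show ?thesis
  proof
    have "I \<subseteq> sum_ideal V W I J"
      using sum_ideal_prod[of _ V 1 W I J] IV(1) by auto
    moreover have "J \<subseteq> sum_ideal V W I J"
      using sum_ideal_prod[of 1 V _ W I J] JW(1) by auto
    ultimately have "Idl\<^bsub>?R\<^esub> I \<subseteq> sum_ideal V W I J" "Idl\<^bsub>?R\<^esub> J \<subseteq> sum_ideal V W I J"
      using genideal_minimal[OF SI] by auto
    then show "ext_sum ?R I J \<subseteq> sum_ideal V W I J"
      unfolding ext using sum_ideal_add by blast
    show "sum_ideal V W I J \<subseteq> ext_sum ?R I J"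
    proof
      fix p assume "p \<in> sum_ideal V W I J"
      then show "p \<in> ext_sum ?R I J"
      proof (induction rule: sum_ideal.induct)
        case zero
        show ?case unfolding ext
          using ideal_mpoly_ringD(2)[OF idl(1)] ideal_mpoly_ringD(2)[OF idl(2)] by force
      next
        case (step a b p)
        then obtain x y where p: "p = x + y" and x: "x \<in> Idl\<^bsub>?R\<^esub> I" and y: "y \<in> Idl\<^bsub>?R\<^esub> J"
          unfolding ext by auto
        have a: "a \<in> carrier ?R" and b: "b \<in> carrier ?R"
          using step.hyps Pol_mono[of V "V \<union> W"] Pol_mono[of W "V \<union> W"] by auto
        from \<open>a \<in> I \<or> b \<in> J\<close> show ?case
        proof
          assume "a \<in> I"
          then have "a * b + x \<in> Idl\<^bsub>?R\<^esub> I"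
            using genideal_self[OF sub(1)] b x
            by (intro ideal_mpoly_ringD(3)[OF idl(1)] ideal_mpoly_ringD(5)[OF idl(1)]) auto
          with y show ?thesis unfolding ext p by (auto simp flip: add.assoc)
        next
          assume "b \<in> J"
          then have "a * b + y \<in> Idl\<^bsub>?R\<^esub> J"
            using genideal_self[OF sub(2)] a y
            by (intro ideal_mpoly_ringD(3)[OF idl(2)] ideal_mpoly_ringD(4)[OF idl(2)]) auto
          with x show ?thesis unfolding ext p by (auto simp: add.left_commute)
        qed
      qed
    qed
  qed
qed

text \<open>
  Polynomials form a vector space over \<open>K\<close> in which scalars act as constant polynomials.
\<close>

abbreviation const_mult :: "'k::field \<Rightarrow> ('v, 'k) mpoly \<Rightarrow> ('v, 'k) mpoly" where
  "const_mult c p \<equiv> Poly_Mapping.single 0 c * p"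

text \<open>
  A basis of \<open>U\<close> stays independent when \<open>x\<close> is added, so values on the enlarged basis can be
  prescribed.
\<close>

lemma separating_functional:
  fixes U :: "('v, 'k::field) mpoly set"
  assumes x: "x \<notin> U"
    and U: "0 \<in> U" "\<And>p q. p \<in> U \<Longrightarrow> q \<in> U \<Longrightarrow> p + q \<in> U" "\<And>c p. p \<in> U \<Longrightarrow> const_mult c p \<in> U"
  obtains \<phi> :: "('v, 'k) mpoly \<Rightarrow> 'k" where
    "\<And>p q. \<phi> (p + q) = \<phi> p + \<phi> q" "\<And>c p. \<phi> (const_mult c p) = c * \<phi> p"
    "\<And>u. u \<in> U \<Longrightarrow> \<phi> u = 0" "\<phi> x = 1"
proof -
  interpret vs: vector_space "const_mult :: 'k \<Rightarrow> ('v, 'k) mpoly \<Rightarrow> ('v, 'k) mpoly"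
    by unfold_locales
      (simp_all add: distrib_left distrib_right single_add mult_single flip: mult.assoc)
  interpret vp: vector_space_pair "const_mult :: 'k \<Rightarrow> ('v, 'k) mpoly \<Rightarrow> ('v, 'k) mpoly" "(*) :: 'k \<Rightarrow> 'k \<Rightarrow> 'k"
    by unfold_locales (simp_all add: algebra_simps)
  have sub: "vs.subspace U" using U by (auto simp: vs.subspace_def)
  obtain B where B: "B \<subseteq> U" "vs.independent B" "U \<subseteq> vs.span B"
    using vs.maximal_independent_subset by blast
  have "vs.span B = U" using B sub vs.span_subspace by blast
  with x B(2) have "vs.independent (insert x B)" by (simp add: vs.independent_insertI)
  then obtain \<phi> where lin: "Vector_Spaces.linear const_mult (*) \<phi>"
    and \<phi>: "\<forall>y\<in>insert x B. \<phi> y = (if y = x then 1 else 0)"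
    using vp.linear_independent_extend[of _ "\<lambda>y. if y = x then 1 else 0"] by blast
  interpret lin: Vector_Spaces.linear const_mult "(*)" \<phi> by (rule lin)
  show thesis
  proof (rule that[of \<phi>])
    show "\<phi> u = 0" if "u \<in> U" for u
    proof -
      have "u \<in> vs.span B" using B that by blast
      moreover have "\<forall>y\<in>B. \<phi> y = 0" using \<phi> x B(1) by auto
      ultimately show ?thesis using lin.eq_0_on_span by blast
    qed
  qed (use \<phi> in \<open>simp_all add: lin.add lin.scale\<close>)
qed

text \<open>
  The map \<open>\<phi> \<otimes> id : K[V] \<otimes> K[W] \<rightarrow> K[W]\<close> for a linear functional \<open>\<phi>\<close> on \<open>K[V]\<close>, written out on
  monomials.
\<close>

definition contract ::
    "'v set \<Rightarrow> 'v set \<Rightarrow> (('v, 'k::field) mpoly \<Rightarrow> 'k) \<Rightarrow> ('v, 'k) mpoly \<Rightarrow> ('v, 'k) mpoly" where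
  "contract V W \<phi> p = (\<Sum>m\<in>Poly_Mapping.keys p. Poly_Mapping.single (restrict_monomial W m)
     (Poly_Mapping.lookup p m * \<phi> (Poly_Mapping.single (restrict_monomial V m) 1)))"

lemma contract_zero: "contract V W \<phi> 0 = 0"
  by (simp add: contract_def)

lemma contract_add: "contract V W \<phi> (p + q) = contract V W \<phi> p + contract V W \<phi> q"
  unfolding contract_def
  by (rule setsum_keys_plus_distrib) (simp_all add: single_add distrib_right)

lemma contract_sum: "contract V W \<phi> (\<Sum>i\<in>F. p i) = (\<Sum>i\<in>F. contract V W \<phi> (p i))"
  by (induction F rule: infinite_finite_induct) (simp_all add: contract_zero contract_add)

lemma contract_single:
  "contract V W \<phi> (Poly_Mapping.single m c) =
     Poly_Mapping.single (restrict_monomial W m) (c * \<phi> (Poly_Mapping.single (restrict_monomial V m) 1))"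
  by (simp add: contract_def)

lemma contract_mult:
  assumes disj: "V \<inter> W = {}" and a: "a \<in> Pol V" and b: "b \<in> Pol W"
    and add: "\<And>p q. \<phi> (p + q) = \<phi> p + \<phi> q" and scale: "\<And>c p. \<phi> (const_mult c p) = c * \<phi> p"
  shows "contract V W \<phi> (a * b) = const_mult (\<phi> a) b"
proof -
  let ?l = Poly_Mapping.lookup and ?s = Poly_Mapping.single
  have \<phi>0: "\<phi> 0 = 0" using scale[of 0 0] by simp
  have \<phi>_sum: "\<phi> (\<Sum>i\<in>F. p i) = (\<Sum>i\<in>F. \<phi> (p i))" for F and p :: "('a \<Rightarrow>\<^sub>0 nat) \<Rightarrow> _"
    by (induction F rule: infinite_finite_induct) (simp_all add: \<phi>0 add)
  have \<phi>_a: "\<phi> a = (\<Sum>m\<in>Poly_Mapping.keys a. ?l a m * \<phi> (?s m 1))"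
    by (subst mpoly_eq_sum_single[of a]) (simp add: \<phi>_sum mult_single flip: scale)
  have "a * b = (\<Sum>m\<in>Poly_Mapping.keys a. \<Sum>n\<in>Poly_Mapping.keys b. ?s (m + n) (?l a m * ?l b n))"
    by (subst mpoly_eq_sum_single[of a], subst mpoly_eq_sum_single[of b])
      (simp add: sum_product mult_single)
  then have "contract V W \<phi> (a * b) = (\<Sum>m\<in>Poly_Mapping.keys a. \<Sum>n\<in>Poly_Mapping.keys b.
      ?s (restrict_monomial W (m + n)) (?l a m * ?l b n * \<phi> (?s (restrict_monomial V (m + n)) 1)))"
    by (simp add: contract_sum contract_single)
  also have "\<dots> = (\<Sum>m\<in>Poly_Mapping.keys a. \<Sum>n\<in>Poly_Mapping.keys b.
      ?s 0 (?l a m * \<phi> (?s m 1)) * ?s n (?l b n))"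
  proof (intro sum.cong refl)
    fix m n assume "m \<in> Poly_Mapping.keys a" "n \<in> Poly_Mapping.keys b"
    then have "Poly_Mapping.keys m \<subseteq> V" "Poly_Mapping.keys n \<subseteq> W" using a b by (auto simp: Pol_iff)
    then have "restrict_monomial W (m + n) = n" "restrict_monomial V (m + n) = m"
      using disj
      by (auto simp: restrict_monomial_add restrict_monomial_id intro!: restrict_monomial_zero)
    then show "?s (restrict_monomial W (m + n)) (?l a m * ?l b n * \<phi> (?s (restrict_monomial V (m + n)) 1)) =
      ?s 0 (?l a m * \<phi> (?s m 1)) * ?s n (?l b n)"
      by (simp add: mult_single ac_simps)
  qed
  also have "\<dots> = (\<Sum>m\<in>Poly_Mapping.keys a. ?s 0 (?l a m * \<phi> (?s m 1))) *
      (\<Sum>n\<in>Poly_Mapping.keys b. ?s n (?l b n))"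
    by (simp add: sum_product)
  also have "(\<Sum>m\<in>Poly_Mapping.keys a. ?s 0 (?l a m * \<phi> (?s m 1))) = ?s 0 (\<phi> a)"
    unfolding \<phi>_a by (induction "Poly_Mapping.keys a" rule: infinite_finite_induct)
      (rule poly_mapping_eqI, auto simp: lookup_sum lookup_single when_def)+
  finally show ?thesis by (simp flip: mpoly_eq_sum_single)
qed

definition indep_mod :: "('v, 'k::field) mpoly set \<Rightarrow> 'i set \<Rightarrow> ('i \<Rightarrow> ('v, 'k) mpoly) \<Rightarrow> bool" where
  "indep_mod I F a \<longleftrightarrow> (\<forall>c. (\<Sum>i\<in>F. const_mult (c i) (a i)) \<in> I \<longrightarrow> (\<forall>i\<in>F. c i = 0))"

text \<open>
  In the language of tensor products: if the classes of the \<open>a i\<close> are independent in \<open>K[V]/I\<close>, then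
  \<open>\<Sum> a i \<otimes> b i\<close> vanishes in \<open>K[V]/I \<otimes> K[W]/J\<close> only if all \<open>b i\<close> vanish in \<open>K[W]/J\<close>. Contraction with
  a functional that is \<open>1\<close> on \<open>a j\<close> and vanishes on \<open>I\<close> and on the other \<open>a i\<close> extracts \<open>b j\<close>, while
  it maps the whole of \<open>sum_ideal V W I J\<close> into \<open>J\<close>.
\<close>

lemma sum_ideal_coeff_mem:
  assumes disj: "V \<inter> W = {}" and I: "ideal I (mpoly_ring V)" and J: "ideal J (mpoly_ring W)"
    and F: "finite F" and a: "\<And>i. i \<in> F \<Longrightarrow> a i \<in> Pol V" and b: "\<And>i. i \<in> F \<Longrightarrow> b i \<in> Pol W"
    and indep: "indep_mod I F a"
    and mem: "(\<Sum>i\<in>F. a i * b i) \<in> sum_ideal V W I J" and j: "j \<in> F"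
  shows "b j \<in> J"
proof -
  note ID = ideal_mpoly_ringD[OF I] and JD = ideal_mpoly_ringD[OF J]
  \<comment> \<open>the span of \<open>I\<close> and all \<open>a i\<close> with \<open>i \<noteq> j\<close>\<close>
  define U where "U = {(\<Sum>i\<in>F - {j}. const_mult (c i) (a i)) + s | c s. s \<in> I}"
  have UI: "(\<Sum>i\<in>F - {j}. const_mult (c i) (a i)) + s \<in> U" if "s \<in> I" for c s
    using that unfolding U_def by (intro CollectI exI conjI) (rule refl)
  have ajU: "a j \<notin> U"
  proof
    assume "a j \<in> U"
    then obtain c s where s: "s \<in> I" and aj: "a j = (\<Sum>i\<in>F - {j}. const_mult (c i) (a i)) + s"
      by (auto simp: U_def)
    \<comment> \<open>coefficient \<open>-1\<close> at \<open>j\<close> turns the expression of \<open>a j\<close> into a nontrivial relation modulo \<open>I\<close>\<close>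
    have "(\<Sum>i\<in>F. const_mult ((c(j := -1)) i) (a i)) =
        const_mult (-1) (a j) + (\<Sum>i\<in>F - {j}. const_mult ((c(j := -1)) i) (a i))"
      using F j by (simp add: sum.remove)
    also have "(\<Sum>i\<in>F - {j}. const_mult ((c(j := -1)) i) (a i)) = (\<Sum>i\<in>F - {j}. const_mult (c i) (a i))"
      by (rule sum.cong) auto
    also have "const_mult (-1) (a j) + \<dots> = - s"
      by (subst aj) (simp add: single_uminus)
    finally have "(\<Sum>i\<in>F. const_mult ((c(j := -1)) i) (a i)) \<in> I"
      using ideal_mpoly_ring_uminus[OF I s] by simp
    with indep j show False unfolding indep_mod_def by fastforce
  qed
  have U0: "0 \<in> U"
    using UI[OF ID(2), of "\<lambda>_. 0"] by simp
  have Uadd: "p + q \<in> U" if "p \<in> U" "q \<in> U" for p q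
  proof -
    from that obtain c s d t where st: "s \<in> I" "t \<in> I"
      and p: "p = (\<Sum>i\<in>F - {j}. const_mult (c i) (a i)) + s"
      and q: "q = (\<Sum>i\<in>F - {j}. const_mult (d i) (a i)) + t" by (auto simp: U_def)
    have "p + q = (\<Sum>i\<in>F - {j}. const_mult (c i + d i) (a i)) + (s + t)"
      by (simp add: p q single_add distrib_right sum.distrib)
    then show ?thesis using UI[OF ID(3)[OF st], of "\<lambda>i. c i + d i"] by simp
  qed
  have Uscale: "const_mult e p \<in> U" if "p \<in> U" for e p
  proof -
    from that obtain c s where s: "s \<in> I"
      and p: "p = (\<Sum>i\<in>F - {j}. const_mult (c i) (a i)) + s" by (auto simp: U_def)
    have "const_mult e p = (\<Sum>i\<in>F - {j}. const_mult (e * c i) (a i)) + const_mult e s"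
      by (simp add: p distrib_left sum_distrib_left mult_single flip: mult.assoc)
    then show ?thesis
      using UI[OF ID(4)[OF s, of "Poly_Mapping.single 0 e"], of "\<lambda>i. e * c i"] by simp
  qed
  obtain \<phi> where add: "\<And>p q. \<phi> (p + q) = \<phi> p + \<phi> q"
    and scale: "\<And>c p. \<phi> (const_mult c p) = c * \<phi> p"
    and \<phi>U: "\<And>u. u \<in> U \<Longrightarrow> \<phi> u = 0" and \<phi>j: "\<phi> (a j) = 1"
    using separating_functional[OF ajU U0 Uadd Uscale] by blast
  have \<phi>I: "\<phi> s = 0" if "s \<in> I" for s
    using \<phi>U[OF UI[OF that, of "\<lambda>_. 0"]] by simp
  have \<phi>i: "\<phi> (a i) = 0" if "i \<in> F" "i \<noteq> j" for i
  proof (rule \<phi>U)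
    have "a i = (\<Sum>k\<in>F - {j}. const_mult (if k = i then 1 else 0) (a k)) + 0"
      using that F by (subst sum.remove[of _ i]) auto
    then show "a i \<in> U" using UI[OF ID(2), of "\<lambda>k. if k = i then 1 else 0"] by simp
  qed
  have contract_mem: "contract V W \<phi> p \<in> J" if "p \<in> sum_ideal V W I J" for p
    using that
  proof (induction rule: sum_ideal.induct)
    case zero
    show ?case by (simp add: contract_zero JD(2))
  next
    case (step a b p)
    then have "const_mult (\<phi> a) b \<in> J" using \<phi>I JD(2) JD(4)[of b "Poly_Mapping.single 0 (\<phi> a)"] by auto
    with step show ?case by (simp add: contract_add contract_mult[OF disj _ _ add scale] JD(3))
  qed
  have "contract V W \<phi> (\<Sum>i\<in>F. a i * b i) = (\<Sum>i\<in>F. const_mult (\<phi> (a i)) (b i))"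
    unfolding contract_sum by (rule sum.cong) (simp_all add: contract_mult[OF disj a b add scale])
  also have "\<dots> = b j"
    using F j by (subst sum.remove[of _ j]) (auto simp: \<phi>j \<phi>i)
  finally show ?thesis using contract_mem[OF mem] by simp
qed

text \<open>
  A dependence \<open>\<Sum> c i a i \<in> I\<close> with \<open>c k \<noteq> 0\<close> expresses \<open>a k\<close> modulo \<open>I\<close> by the other \<open>a i\<close>. Substituting
  this into \<open>\<Sum> a i b i\<close> removes the term at \<open>k\<close>, at the price of new cofactors \<open>b' i\<close>.
\<close>

lemma shorten_representation:
  assumes I: "ideal I (mpoly_ring V)"
    and F: "finite F" and a: "\<And>i. i \<in> F \<Longrightarrow> a i \<in> Pol V" and b: "\<And>i. i \<in> F \<Longrightarrow> b i \<in> Pol W"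
    and dep: "\<not> indep_mod I F a"
  obtains k b' where "k \<in> F" "\<And>i. i \<in> F \<Longrightarrow> b' i \<in> Pol W"
    "(\<Sum>i\<in>F. a i * b i) - (\<Sum>i\<in>F - {k}. a i * b' i) \<in> sum_ideal V W I J"
proof -
  from dep obtain c k where k: "k \<in> F" "c k \<noteq> 0"
    and mem: "(\<Sum>i\<in>F. const_mult (c i) (a i)) \<in> I" unfolding indep_mod_def by auto
  define b' where "b' i = b i - const_mult (c i / c k) (b k)" for i
  have b': "b' i \<in> Pol W" if "i \<in> F" for i
    using Pol_add[OF b[OF that] Pol_uminus[OF Pol_mult[OF Pol_single b[OF k(1)]]]] by (simp add: b'_def)
  \<comment> \<open>by its definition \<open>b' k = 0\<close>, so the term at \<open>k\<close> may be restored\<close>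
  have "(\<Sum>i\<in>F. a i * b i) - (\<Sum>i\<in>F - {k}. a i * b' i) = (\<Sum>i\<in>F. a i * b i) - (\<Sum>i\<in>F. a i * b' i)"
    using F k by (simp add: sum.remove[of F k] b'_def)
  also have "\<dots> = (\<Sum>i\<in>F. const_mult (c i / c k) (a i) * b k)"
    by (simp add: b'_def algebra_simps sum_subtractf)
  also have "\<dots> = const_mult (1 / c k) (\<Sum>i\<in>F. const_mult (c i) (a i)) * b k"
    by (simp add: sum_distrib_left sum_distrib_right mult_single flip: mult.assoc)
  also have "\<dots> \<in> sum_ideal V W I J"
    using ideal_mpoly_ringD(1,4)[OF I] mem b[OF k(1)] by (intro sum_ideal_prod) auto
  finally show thesis using that k(1) b' by blast
qed

text \<open>
  A representation with the least number of terms cannot be shortened by eliminating some \<open>a k\<close> or, by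
  symmetry, some \<open>b k\<close>. The terms are indexed by monomials because the representation to start from
  is the expansion of \<open>q\<close> into monomials.
\<close>

lemma independent_representation:
  assumes disj: "V \<inter> W = {}" and I: "ideal I (mpoly_ring V)" and J: "ideal J (mpoly_ring W)"
    and q: "q \<in> Pol (V \<union> W)"
  obtains F :: "('v \<Rightarrow>\<^sub>0 nat) set" and a b :: "('v \<Rightarrow>\<^sub>0 nat) \<Rightarrow> ('v, 'k::field) mpoly" where
    "finite F" "\<And>i. i \<in> F \<Longrightarrow> a i \<in> Pol V" "\<And>i. i \<in> F \<Longrightarrow> b i \<in> Pol W"
    "q - (\<Sum>i\<in>F. a i * b i) \<in> sum_ideal V W I J" "indep_mod I F a" "indep_mod J F b"
proof -
  define rep where "rep F a b \<longleftrightarrow> finite F \<and> (\<forall>i\<in>F. a i \<in> Pol V) \<and> (\<forall>i\<in>F. b i \<in> Pol W) \<and>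
    q - (\<Sum>i\<in>F. a i * b i) \<in> sum_ideal V W I J"
    for F :: "('v \<Rightarrow>\<^sub>0 nat) set" and a b :: "('v \<Rightarrow>\<^sub>0 nat) \<Rightarrow> ('v, 'k::field) mpoly"
  let ?P = "\<lambda>n. \<exists>F a b. rep F a b \<and> card F = n"
  have "rep (Poly_Mapping.keys q)
      (\<lambda>m. Poly_Mapping.single (restrict_monomial V m) (Poly_Mapping.lookup q m))
      (\<lambda>m. Poly_Mapping.single (restrict_monomial W m) 1)"
    unfolding rep_def
    by (simp add: keys_restrict_monomial sum_ideal.zero flip: Pol_Un_eq_sum_products[OF disj q])
  then have "?P (LEAST n. ?P n)" by (intro LeastI[of ?P]) blast
  then obtain F a b where rep: "rep F a b" and card: "card F = (LEAST n. ?P n)" by blast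
  have least: "card F \<le> card F'" if "rep F' a' b'" for F' a' b'
    unfolding card using that by (intro Least_le) blast
  from rep have F: "finite F" and a: "\<And>i. i \<in> F \<Longrightarrow> a i \<in> Pol V" and b: "\<And>i. i \<in> F \<Longrightarrow> b i \<in> Pol W"
    and mem: "q - (\<Sum>i\<in>F. a i * b i) \<in> sum_ideal V W I J" by (auto simp: rep_def)
  have smaller: "card (F - {k}) < card F" if "k \<in> F" for k
    using F that by (meson card_Diff1_less)
  have "indep_mod I F a"
  proof (rule ccontr)
    assume "\<not> indep_mod I F a"
    from shorten_representation[where b = b and J = J, OF I F a b this] obtain k b' where k: "k \<in> F"
      and b': "\<And>i. i \<in> F \<Longrightarrow> b' i \<in> Pol W"
      and d: "(\<Sum>i\<in>F. a i * b i) - (\<Sum>i\<in>F - {k}. a i * b' i) \<in> sum_ideal V W I J" by blast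
    have "rep (F - {k}) a b'"
      using F a b' sum_ideal_add[OF mem d] by (simp add: rep_def)
    with least smaller[OF k] show False by force
  qed
  moreover have "indep_mod J F b"
  proof (rule ccontr)
    assume "\<not> indep_mod J F b"
    from shorten_representation[where b = a and J = I, OF J F b a this] obtain k a' where k: "k \<in> F"
      and a': "\<And>i. i \<in> F \<Longrightarrow> a' i \<in> Pol V"
      and d: "(\<Sum>i\<in>F. b i * a i) - (\<Sum>i\<in>F - {k}. b i * a' i) \<in> sum_ideal W V J I" by blast
    have "(\<Sum>i\<in>F. a i * b i) - (\<Sum>i\<in>F - {k}. a' i * b i) \<in> sum_ideal V W I J"
      using d by (simp add: mult.commute sum_ideal_commute[of W])
    from sum_ideal_add[OF mem this] have "rep (F - {k}) a' b"
      using F a' b by (simp add: rep_def)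
    with least smaller[OF k] show False by force
  qed
  ultimately show thesis using that F a b mem by blast
qed

section \<open>Homogeneous components\<close>

lemma lookup_hom_component:
  "Poly_Mapping.lookup (hom_component d p) m = (Poly_Mapping.lookup p m when mono_deg m = d)"
  unfolding hom_component_def
  by (auto simp: lookup_sum lookup_single when_def in_keys_iff)

lemma hom_component_zero [simp]: "hom_component d 0 = 0"
  by (simp add: hom_component_def)

lemma hom_component_add: "hom_component d (p + q) = hom_component d p + hom_component d q"
  by (rule poly_mapping_eqI) (simp add: lookup_hom_component lookup_add when_def)

lemma hom_component_sum: "hom_component d (\<Sum>i\<in>F. p i) = (\<Sum>i\<in>F. hom_component d (p i))"
  by (induction F rule: infinite_finite_induct) (simp_all add: hom_component_add)

lemma keys_hom_component:
  "Poly_Mapping.keys (hom_component d p) = {m \<in> Poly_Mapping.keys p. mono_deg m = d}"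
  by (auto simp: in_keys_iff lookup_hom_component)

lemma hom_component_graded_piece: "p \<in> Pol V \<Longrightarrow> hom_component d p \<in> graded_piece V d"
  by (auto simp: graded_piece_def Pol_iff keys_hom_component)

lemma graded_piece_Pol: "p \<in> graded_piece V d \<Longrightarrow> p \<in> Pol V"
  by (simp add: graded_piece_def)

lemma graded_piece_mono: "V \<subseteq> W \<Longrightarrow> p \<in> graded_piece V d \<Longrightarrow> p \<in> graded_piece W d"
  by (auto simp: graded_piece_def intro: Pol_mono)

lemma hom_component_Pol: "p \<in> Pol V \<Longrightarrow> hom_component d p \<in> Pol V"
  by (rule graded_piece_Pol[OF hom_component_graded_piece])

lemma hom_component_of_graded_piece:
  "p \<in> graded_piece V e \<Longrightarrow> hom_component d p = (if d = e then p else 0)"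
  by (auto intro!: poly_mapping_eqI simp: lookup_hom_component graded_piece_def when_def in_keys_iff)

lemma mpoly_eq_sum_hom_component:
  "p = (\<Sum>d\<in>mono_deg ` Poly_Mapping.keys p. hom_component d p)"
  by (rule poly_mapping_eqI) (auto simp: lookup_sum lookup_hom_component when_def in_keys_iff)

lemma hom_component_eq_zero: "d \<notin> mono_deg ` Poly_Mapping.keys p \<Longrightarrow> hom_component d p = 0"
  by (rule poly_mapping_eqI) (auto simp: lookup_hom_component when_def in_keys_iff)

lemma mono_deg_add: "mono_deg (m + n) = mono_deg m + mono_deg n"
proof -
  let ?K = "Poly_Mapping.keys m \<union> Poly_Mapping.keys n"
  have "mono_deg k = (\<Sum>x\<in>?K. Poly_Mapping.lookup k x)" if "Poly_Mapping.keys k \<subseteq> ?K" for k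
    unfolding mono_deg_def using that by (intro sum.mono_neutral_left) (auto simp: in_keys_iff)
  then show ?thesis by (simp add: keys_add_monomial lookup_add sum.distrib)
qed

lemma graded_piece_mult:
  assumes "p \<in> graded_piece V d" "q \<in> graded_piece V e"
  shows "p * q \<in> graded_piece V (d + e)"
  using assms keys_mult[of p q] by (fastforce simp: graded_piece_def Pol_mult mono_deg_add)

lemma graded_piece_one: "1 \<in> graded_piece V 0"
  by (simp add: graded_piece_def mono_deg_def)

text \<open>
  Multiplication by a form of degree \<open>k\<close> shifts homogeneous components by \<open>k\<close>.
\<close>

lemma hom_component_mult_graded_piece:
  assumes p: "p \<in> Pol V" and q: "q \<in> graded_piece V k"
  shows "hom_component d (p * q) = (if k \<le> d then hom_component (d - k) p * q else 0)"
proof -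
  let ?D = "mono_deg ` Poly_Mapping.keys p"
  have "p * q = (\<Sum>i\<in>?D. hom_component i p * q)"
    by (subst mpoly_eq_sum_hom_component[of p]) (simp add: sum_distrib_right)
  then have "hom_component d (p * q) = (\<Sum>i\<in>?D. hom_component d (hom_component i p * q))"
    by (simp add: hom_component_sum)
  also have "\<dots> = (\<Sum>i\<in>?D. if i + k = d then hom_component i p * q else 0)"
    using hom_component_of_graded_piece[OF graded_piece_mult[OF hom_component_graded_piece[OF p] q]]
    by (intro sum.cong) auto
  also have "\<dots> = (\<Sum>i\<in>?D. if i = d - k then (if k \<le> d then hom_component (d - k) p * q else 0) else 0)"
    by (intro sum.cong) auto
  also have "\<dots> = (if k \<le> d then hom_component (d - k) p * q else 0)"
    using hom_component_eq_zero[of "d - k" p] by simp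
  finally show ?thesis .
qed

lemma hom_component_mult:
  fixes a b :: "('v, 'k::field) mpoly"
  shows "hom_component d (a * b) = (\<Sum>i\<le>d. hom_component i a * hom_component (d - i) b)"
proof -
  let ?D = "mono_deg ` Poly_Mapping.keys a"
  \<comment> \<open>every polynomial lies in the ring in all indeterminates, so the result on forms applies\<close>
  have ab: "a \<in> Pol UNIV" "b \<in> Pol UNIV" by (simp_all add: Pol_iff)
  have "a * b = (\<Sum>i\<in>?D. b * hom_component i a)"
    by (subst mpoly_eq_sum_hom_component[of a]) (simp add: sum_distrib_left mult.commute)
  then have "hom_component d (a * b) = (\<Sum>i\<in>?D. hom_component d (b * hom_component i a))"
    by (simp add: hom_component_sum)
  also have "\<dots> = (\<Sum>i\<in>?D. if i \<le> d then hom_component i a * hom_component (d - i) b else 0)"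
    using hom_component_mult_graded_piece[OF ab(2) hom_component_graded_piece[OF ab(1)]]
    by (intro sum.cong) (auto simp: mult.commute)
  also have "\<dots> = (\<Sum>i\<in>?D \<union> {..d}. if i \<le> d then hom_component i a * hom_component (d - i) b else 0)"
    by (rule sum.mono_neutral_left) (auto simp: hom_component_eq_zero)
  also have "\<dots> = (\<Sum>i\<le>d. hom_component i a * hom_component (d - i) b)"
    by (rule sum.mono_neutral_cong_right) auto
  finally show ?thesis .
qed

lemma graded_idealD:
  "graded_ideal V I \<Longrightarrow> ideal I (mpoly_ring V)"
  "graded_ideal V I \<Longrightarrow> p \<in> I \<Longrightarrow> hom_component d p \<in> I"
  by (simp_all add: graded_ideal_def)

lemma graded_ideal_colon:
  assumes I: "graded_ideal V I" and f: "f \<in> graded_piece V k"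
  shows "graded_ideal V (colon (mpoly_ring V) I f)"
  unfolding graded_ideal_def
proof (intro conjI ballI allI)
  show "ideal (colon (mpoly_ring V) I f) (mpoly_ring V)"
    using ideal_colon graded_idealD(1)[OF I] graded_piece_Pol[OF f] .
  fix p d assume "p \<in> colon (mpoly_ring V) I f"
  then have p: "p \<in> Pol V" "p * f \<in> I" by (auto simp: colon_def)
  from hom_component_mult_graded_piece[OF p(1) f, of "d + k"] graded_idealD(2)[OF I p(2), of "d + k"]
  show "hom_component d p \<in> colon (mpoly_ring V) I f"
    by (simp add: colon_def hom_component_Pol p(1))
qed

lemma graded_ideal_sum_ideal:
  assumes "V \<inter> W = {}" and I: "graded_ideal V I" and J: "graded_ideal W J"
  shows "graded_ideal (V \<union> W) (sum_ideal V W I J)"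
  unfolding graded_ideal_def
proof (intro conjI ballI allI)
  show "ideal (sum_ideal V W I J) (mpoly_ring (V \<union> W))"
    using ideal_sum_ideal assms graded_idealD(1) by blast
  fix p d assume "p \<in> sum_ideal V W I J"
  then show "hom_component d p \<in> sum_ideal V W I J"
  proof (induction rule: sum_ideal.induct)
    case (step a b p)
    have "hom_component d (a * b) \<in> sum_ideal V W I J"
      unfolding hom_component_mult
    proof (rule sum_ideal_sum)
      fix i
      show "hom_component i a * hom_component (d - i) b \<in> sum_ideal V W I J"
        using step graded_idealD(2)[OF I] graded_idealD(2)[OF J]
        by (intro sum_ideal_prod) (auto simp: hom_component_Pol)
    qed
    with step show ?case by (simp add: hom_component_add sum_ideal_add)
  qed (simp add: sum_ideal.zero)
qed

lemma exists_least_hom_component_notin: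
  assumes I: "ideal I (mpoly_ring V)" and a: "a \<notin> I"
  obtains s where "hom_component s a \<notin> I" "\<And>i. i < s \<Longrightarrow> hom_component i a \<in> I"
proof -
  have "\<exists>s. hom_component s a \<notin> I"
    using a mpoly_eq_sum_hom_component[of a] ideal_mpoly_ring_sum[OF I, of _ "\<lambda>d. hom_component d a"]
    by metis
  then show thesis using that exists_least_iff[of "\<lambda>s. hom_component s a \<notin> I"] by blast
qed

text \<open>
  If \<open>a\<close> and \<open>b\<close> are outside \<open>J\<close>, let \<open>s\<close> and \<open>t\<close> be the least degrees in which their components are
  outside \<open>J\<close>. In the component of degree \<open>s + t\<close> of \<open>a b\<close>, every summand except \<open>a\<^sub>s b\<^sub>t\<close> has a factor
  in \<open>J\<close>. Hence \<open>a b \<in> J\<close> would imply \<open>a\<^sub>s b\<^sub>t \<in> J\<close>, against primality for homogeneous elements.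
\<close>

lemma graded_primeidealI:
  assumes J: "graded_ideal V J" and ne: "Pol V \<noteq> J"
    and prime: "\<And>g h d e. g \<in> graded_piece V d \<Longrightarrow> h \<in> graded_piece V e \<Longrightarrow> g * h \<in> J \<Longrightarrow> g \<in> J \<or> h \<in> J"
  shows "primeideal J (mpoly_ring V)"
proof (rule primeidealI)
  note JI = graded_idealD(1)[OF J]
  note JD = ideal_mpoly_ringD[OF JI]
  fix a b assume "a \<in> carrier (mpoly_ring V)" "b \<in> carrier (mpoly_ring V)"
    and "a \<otimes>\<^bsub>mpoly_ring V\<^esub> b \<in> J"
  then have a: "a \<in> Pol V" and b: "b \<in> Pol V" and ab: "a * b \<in> J" by auto
  show "a \<in> J \<or> b \<in> J"
  proof (rule ccontr)
    assume "\<not> (a \<in> J \<or> b \<in> J)"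
    then obtain s t where s: "hom_component s a \<notin> J" "\<And>i. i < s \<Longrightarrow> hom_component i a \<in> J"
      and t: "hom_component t b \<notin> J" "\<And>i. i < t \<Longrightarrow> hom_component i b \<in> J"
      using exists_least_hom_component_notin[OF JI] by metis
    let ?term = "\<lambda>i. hom_component i a * hom_component (s + t - i) b"
    have "?term i \<in> J" if "i \<in> {..s + t} - {s}" for i
    proof (cases "i < s")
      case True
      then show ?thesis using JD(5)[OF s(2)[OF True] hom_component_Pol[OF b]] by simp
    next
      case False
      with that have "s + t - i < t" by auto
      from JD(4)[OF t(2)[OF this] hom_component_Pol[OF a]] show ?thesis by simp
    qed
    then have rest: "(\<Sum>i\<in>{..s + t} - {s}. ?term i) \<in> J" by (intro ideal_mpoly_ring_sum[OF JI])
    have "hom_component (s + t) (a * b) = ?term s + (\<Sum>i\<in>{..s + t} - {s}. ?term i)"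
      unfolding hom_component_mult by (rule sum.remove) auto
    then have "hom_component s a * hom_component t b =
        hom_component (s + t) (a * b) - (\<Sum>i\<in>{..s + t} - {s}. ?term i)"
      by simp
    then have "hom_component s a * hom_component t b \<in> J"
      using ideal_mpoly_ring_diff[OF JI graded_idealD(2)[OF J ab] rest] by simp
    with prime[OF hom_component_graded_piece[OF a] hom_component_graded_piece[OF b]] s t
    show False by blast
  qed
qed (use J ne in \<open>auto simp: graded_ideal_def cring_mpoly_ring\<close>)

section \<open>Chains of ideals and homogeneous colon primes\<close>

text \<open>
  A monotone subsequence exists in any linear order; over \<open>nat\<close> a decreasing one is constant from the
  point on where it attains its minimum.
\<close>

lemma incseq_subseq_nat:
  fixes s :: "nat \<Rightarrow> nat"
  obtains r where "strict_mono r" "incseq (s \<circ> r)"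
proof -
  obtain f where f: "strict_mono f" "monoseq (\<lambda>n. s (f n))"
    using seq_monosub by blast
  show thesis
  proof (cases "incseq (\<lambda>n. s (f n))")
    case True
    with f(1) that show thesis by (simp add: o_def)
  next
    case False
    with f(2) have dec: "decseq (\<lambda>n. s (f n))" by (auto simp: monoseq_iff)
    obtain k where k: "\<And>n. s (f k) \<le> s (f n)"
      using ex_has_least_nat[of "\<lambda>_. True" _ "\<lambda>n. s (f n)"] by blast
    have "s (f (k + n)) = s (f k)" for n
      using k[of "k + n"] dec by (auto simp: decseq_def intro: antisym)
    moreover have "strict_mono (\<lambda>n. f (k + n))"
      using f(1) by (simp add: strict_mono_def)
    ultimately show thesis using that[of "\<lambda>n. f (k + n)"] by (simp add: incseq_def)
  qed
qed

text \<open>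
  Dickson's lemma. Passing to an increasing subsequence for one coordinate after the other makes all
  of the finitely many coordinates increase at once.
\<close>

lemma dickson:
  fixes s :: "nat \<Rightarrow> 'v \<Rightarrow> nat"
  assumes "finite V"
  shows "\<exists>r. strict_mono r \<and> (\<forall>v\<in>V. incseq (\<lambda>n. s (r n) v))"
  using assms
proof (induction V)
  case empty
  show ?case by (rule exI[of _ id]) (simp add: strict_mono_def)
next
  case (insert x V)
  then obtain r where r: "strict_mono r" "\<forall>v\<in>V. incseq (\<lambda>n. s (r n) v)" by blast
  obtain q where q: "strict_mono q" "incseq ((\<lambda>n. s (r n) x) \<circ> q)"
    using incseq_subseq_nat by blast
  have "strict_mono (r \<circ> q)" using r(1) q(1) by (rule strict_mono_o)
  moreover have "incseq (\<lambda>n. s ((r \<circ> q) n) v)" if "v \<in> insert x V" for v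
  proof (cases "v = x")
    case True
    with q(2) show ?thesis by (simp add: o_def)
  next
    case False
    with that r(2) have "incseq (\<lambda>n. s (r n) v)" by blast
    with strict_mono_mono[OF q(1)] show ?thesis by (simp add: incseq_def mono_def)
  qed
  ultimately show ?case by blast
qed

lemma lookup_single_mult_shift:
  fixes p :: "('v, 'k::field) mpoly"
  shows "Poly_Mapping.lookup (Poly_Mapping.single t 1 * p) (t + m) = Poly_Mapping.lookup p m"
proof -
  have "Poly_Mapping.single t 1 * p =
      (\<Sum>k\<in>Poly_Mapping.keys p. Poly_Mapping.single (t + k) (Poly_Mapping.lookup p k))"
    by (subst mpoly_eq_sum_single[of p]) (simp add: sum_distrib_left mult_single)
  then show ?thesis
    by (auto simp: lookup_sum lookup_single when_def in_keys_iff)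
qed

lemma lookup_const_mult:
  "Poly_Mapping.lookup (const_mult c p) m = c * Poly_Mapping.lookup p m"
proof -
  have "const_mult c p = (\<Sum>k\<in>Poly_Mapping.keys p. Poly_Mapping.single k (c * Poly_Mapping.lookup p k))"
    by (subst mpoly_eq_sum_single[of p]) (simp add: sum_distrib_left mult_single)
  then show ?thesis
    by (auto simp: lookup_sum lookup_single when_def in_keys_iff)
qed

text \<open>
  Attach distinct primes \<open>g v\<close> to the indeterminates and send \<open>m\<close> to \<open>\<Prod> (g v) ^ m v\<close>. This is
  injective by unique factorization, and comparing the resulting natural numbers is a monomial
  order: a well-order compatible with multiplication of monomials.
\<close>

lemma exists_monomial_weight:
  assumes V: "finite V"
  obtains N :: "('v \<Rightarrow>\<^sub>0 nat) \<Rightarrow> nat" where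
    "\<And>m n. N (m + n) = N m * N n"
    "inj_on N {m. Poly_Mapping.keys m \<subseteq> V}"
proof -
  obtain T where T: "finite T" "card T = card V" "T \<subseteq> {p::nat. Factorial_Ring.prime p}"
    using infinite_arbitrarily_large[OF primes_infinite] by blast
  then obtain g where g: "bij_betw g V T"
    using finite_same_card_bij V by metis
  define N where "N m = (\<Prod>v\<in>V. g v ^ Poly_Mapping.lookup m v)" for m
  show thesis
  proof (rule that[of N])
    show "N (m + n) = N m * N n" for m n
      by (simp add: N_def lookup_add power_add prod.distrib)
    have N_T: "N m = (\<Prod>p\<in>T. p ^ Poly_Mapping.lookup m (inv_into V g p))" for m
      unfolding N_def using g
      by (intro prod.reindex_bij_witness[of _ "inv_into V g" g])
        (auto simp: bij_betw_def inv_into_into inj_on_def)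
    have mult: "multiplicity (g v) (N m) = Poly_Mapping.lookup m v" if v: "v \<in> V" for v m
    proof -
      have "g v \<in> T" "inv_into V g (g v) = v" using g v by (auto simp: bij_betw_def)
      then show ?thesis
        unfolding N_T using T by (subst multiplicity_prod_prime_powers) auto
    qed
    show "inj_on N {m. Poly_Mapping.keys m \<subseteq> V}"
    proof (rule inj_onI)
      fix m n assume mn: "m \<in> {m. Poly_Mapping.keys m \<subseteq> V}" "n \<in> {m. Poly_Mapping.keys m \<subseteq> V}"
        and eq: "N m = N n"
      show "m = n"
      proof (rule poly_mapping_eqI)
        fix v
        show "Poly_Mapping.lookup m v = Poly_Mapping.lookup n v"
        proof (cases "v \<in> V")
          case True
          then show ?thesis using mult[of v m] mult[of v n] eq by simp
        next
          case False
          with mn have "v \<notin> Poly_Mapping.keys m" "v \<notin> Poly_Mapping.keys n" by auto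
          then show ?thesis by (simp add: in_keys_iff)
        qed
      qed
    qed
  qed
qed

text \<open>
  Hilbert's basis theorem. Each ideal of a strict chain must have an element whose leading monomial
  is not one of the preceding ideal: otherwise an element of the difference with least leading
  monomial could be reduced further. By Dickson's lemma one of these new leading monomials divides a
  later one, and then a monomial multiple of the earlier polynomial shows that the later one was not
  new.
\<close>

lemma no_strict_ascending_chain:
  fixes J :: "nat \<Rightarrow> ('v, 'k::field) mpoly set"
  assumes V: "finite V" and J: "\<And>n. ideal (J n) (mpoly_ring V)"
  shows "\<exists>n. \<not> J n \<subset> J (Suc n)"
proof (rule ccontr)
  assume "\<nexists>n. \<not> J n \<subset> J (Suc n)"
  then have chain: "J n \<subset> J (Suc n)" for n by blast
  then have J_mono: "J i \<subseteq> J j" if "i \<le> j" for i j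
    using that lift_Suc_mono_le[of J] by blast
  let ?keys = "Poly_Mapping.keys" and ?l = "Poly_Mapping.lookup"
  obtain N :: "('v \<Rightarrow>\<^sub>0 nat) \<Rightarrow> nat" where N_add: "\<And>m n. N (m + n) = N m * N n"
    and N_inj: "inj_on N {m. ?keys m \<subseteq> V}"
    using exists_monomial_weight[OF V] by blast
  \<comment> \<open>\<open>m\<close> is the leading monomial of \<open>p\<close> with respect to the weight \<open>N\<close>\<close>
  define lm where "lm p m \<longleftrightarrow> m \<in> ?keys p \<and> (\<forall>k\<in>?keys p. N k \<le> N m)"
    for p :: "('v, 'k) mpoly" and m
  have new_lm: "\<exists>f m. f \<in> J (Suc n) \<and> lm f m \<and> (\<forall>g\<in>J n. \<not> lm g m)" for n
  proof -
    note D = ideal_mpoly_ringD[OF J[of n]] and D' = ideal_mpoly_ringD[OF J[of "Suc n"]]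
    obtain f where f: "f \<in> J (Suc n) - J n"
      and least: "\<And>h. h \<in> J (Suc n) - J n \<Longrightarrow> Max (N ` ?keys f) \<le> Max (N ` ?keys h)"
      using ex_has_least_nat[of "\<lambda>f. f \<in> J (Suc n) - J n" _ "\<lambda>f. Max (N ` ?keys f)"] chain[of n]
      by blast
    have keys_ne: "?keys h \<noteq> {}" if "h \<in> J (Suc n) - J n" for h
      using that D(2) by auto
    then have "Max (N ` ?keys f) \<in> N ` ?keys f" using f by (intro Max_in) auto
    then obtain m where m: "m \<in> ?keys f" "N m = Max (N ` ?keys f)" by auto
    have lm_f: "lm f m" unfolding lm_def using m by auto
    have "\<not> lm g m" if g: "g \<in> J n" for g
    proof
      assume lm_g: "lm g m"
      then have gm: "?l g m \<noteq> 0" by (simp add: lm_def in_keys_iff)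
      \<comment> \<open>cancel the leading term of \<open>f\<close>; the difference is still new, but of smaller weight\<close>
      define c where "c = ?l f m / ?l g m"
      define h where "h = f - const_mult c g"
      have cg: "const_mult c g \<in> J n" by (rule D(4)[OF g]) simp
      have "h \<in> J (Suc n)"
        using ideal_mpoly_ring_diff[OF J[of "Suc n"]] f cg chain[of n] unfolding h_def by blast
      moreover have "h \<notin> J n"
        using D(3)[OF _ cg, of h] f by (auto simp: h_def)
      ultimately have h: "h \<in> J (Suc n) - J n" by blast
      have "N k < N m" if k: "k \<in> ?keys h" for k
      proof -
        have "k \<in> ?keys f \<or> k \<in> ?keys g"
          using k by (auto simp: h_def in_keys_iff lookup_minus lookup_const_mult)
        then have le: "N k \<le> N m" using lm_f lm_g by (auto simp: lm_def)
        have "k \<noteq> m" using k gm by (auto simp: h_def in_keys_iff lookup_minus lookup_const_mult c_def)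
        moreover have "?keys k \<subseteq> V" "?keys m \<subseteq> V"
          using h k f m D'(1) by (auto simp: Pol_iff)
        ultimately show ?thesis using le N_inj by (auto simp: inj_on_def le_less)
      qed
      then have "Max (N ` ?keys h) < N m" using keys_ne[OF h] by simp
      with least[OF h] m show False by simp
    qed
    with f lm_f show ?thesis by blast
  qed
  then obtain f m where f: "\<And>n. f n \<in> J (Suc n)" and lm_f: "\<And>n. lm (f n) (m n)"
    and no_lm: "\<And>n g. g \<in> J n \<Longrightarrow> \<not> lm g (m n)"
    by metis
  obtain r where r: "strict_mono r" "\<forall>v\<in>V. incseq (\<lambda>n. ?l (m (r n)) v)"
    using dickson[OF V, of "\<lambda>n. ?l (m n)"] by blast
  define i j where "i = r 0" and "j = r (Suc 0)"
  have ij: "i < j" using r(1) by (simp add: i_def j_def strict_mono_def)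
  have keys_m: "?keys (m n) \<subseteq> V" for n
    using lm_f[of n] f[of n] ideal_mpoly_ringD(1)[OF J] by (auto simp: lm_def Pol_iff)
  have le: "?l (m i) v \<le> ?l (m j) v" for v
  proof (cases "v \<in> V")
    case True
    then show ?thesis using r(2) by (auto simp: i_def j_def incseq_def)
  next
    case False
    with keys_m[of i] have "v \<notin> ?keys (m i)" by blast
    then show ?thesis by (simp add: in_keys_iff)
  qed
  \<comment> \<open>subtraction of exponents does not truncate here, by \<open>le\<close>\<close>
  define t where "t = m j - m i"
  have l_t: "?l t v = ?l (m j) v - ?l (m i) v" for v
    unfolding t_def by transfer simp
  have mj: "m j = t + m i"
    by (rule poly_mapping_eqI) (simp add: lookup_add l_t le)
  have keys_t: "?keys t \<subseteq> V"
    using keys_m[of j] by (auto simp: in_keys_iff l_t)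
  define g where "g = Poly_Mapping.single t 1 * f i"
  have "g \<in> J (Suc i)"
    unfolding g_def using f keys_t by (intro ideal_mpoly_ringD(4)[OF J]) auto
  then have "g \<in> J j" using J_mono[of "Suc i" j] ij by auto
  moreover have "lm g (m j)"
    unfolding lm_def
  proof
    show "m j \<in> ?keys g"
      using lm_f[of i] by (simp add: mj g_def in_keys_iff lookup_single_mult_shift lm_def)
    show "\<forall>k\<in>?keys g. N k \<le> N (m j)"
    proof
      fix k assume "k \<in> ?keys g"
      then obtain k' where "k' \<in> ?keys (f i)" "k = t + k'"
        unfolding g_def using keys_mult[of "Poly_Mapping.single t 1" "f i"] by auto
      then show "N k \<le> N (m j)" using lm_f[of i] by (simp add: lm_def mj N_add)
    qed
  qed
  ultimately show False using no_lm by blast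
qed

text \<open>
  Among the colons of homogeneous elements outside \<open>I\<close>, one is maximal, say \<open>(I : f)\<close>. If \<open>g\<close> and \<open>h\<close>
  are homogeneous with \<open>g h f \<in> I\<close> and \<open>h f \<notin> I\<close>, then \<open>(I : h f)\<close> is again such a colon and contains
  \<open>(I : f)\<close>, so they are equal and \<open>g \<in> (I : f)\<close>. Primality for homogeneous elements is enough.
\<close>

lemma exists_homogeneous_prime_colon:
  fixes I :: "('v, 'k::field) mpoly set"
  assumes V: "finite V" and I: "graded_ideal V I" and ne: "I \<noteq> Pol V"
  obtains d f where "f \<in> graded_piece V d" "primeideal (colon (mpoly_ring V) I f) (mpoly_ring V)"
proof -
  let ?c = "colon (mpoly_ring V) I"
  note II = graded_idealD(1)[OF I]
  define C where "C = {f. f \<notin> I \<and> (\<exists>d. f \<in> graded_piece V d)}"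
  have "1 \<in> C"
  proof -
    have "1 \<notin> I" using ideal_mpoly_ringD(1)[OF II] ideal_mpoly_ringD(4)[OF II, of 1] ne by auto
    then show ?thesis using graded_piece_one by (auto simp: C_def)
  qed
  have "\<exists>f\<in>C. \<forall>g\<in>C. \<not> ?c f \<subset> ?c g"
  proof (rule ccontr)
    assume "\<not> (\<exists>f\<in>C. \<forall>g\<in>C. \<not> ?c f \<subset> ?c g)"
    then have step: "\<exists>g. g \<in> C \<and> ?c f \<subset> ?c g" if "f \<in> C" for f using that by blast
    obtain s where s: "\<And>n. s n \<in> C" "\<And>n. ?c (s n) \<subset> ?c (s (Suc n))"
      using dependent_nat_choice[of "\<lambda>_ f. f \<in> C" "\<lambda>_ f g. ?c f \<subset> ?c g"] step \<open>1 \<in> C\<close> by metis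
    have "ideal (?c (s n)) (mpoly_ring V)" for n
      using s(1)[of n] ideal_colon[OF II] graded_piece_Pol by (auto simp: C_def)
    with no_strict_ascending_chain[OF V, of "\<lambda>n. ?c (s n)"] s(2) show False by blast
  qed
  then obtain f d where f: "f \<notin> I" "f \<in> graded_piece V d"
    and max: "\<And>g. g \<in> C \<Longrightarrow> \<not> ?c f \<subset> ?c g" by (auto simp: C_def)
  have "primeideal (?c f) (mpoly_ring V)"
  proof (rule graded_primeidealI)
    show "graded_ideal V (?c f)" by (rule graded_ideal_colon[OF I f(2)])
    have "1 \<notin> ?c f" using f(1) by (simp add: colon_def)
    then show "Pol V \<noteq> ?c f" using Pol_one by metis
    fix g h i j
    assume g: "g \<in> graded_piece V i" and h: "h \<in> graded_piece V j" and gh: "g * h \<in> ?c f"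
    show "g \<in> ?c f \<or> h \<in> ?c f"
    proof (rule disjCI)
      assume "h \<notin> ?c f"
      then have "h * f \<notin> I" using graded_piece_Pol[OF h] by (simp add: colon_def)
      then have "h * f \<in> C" using graded_piece_mult[OF h f(2)] by (auto simp: C_def)
      moreover have "?c f \<subseteq> ?c (h * f)"
        using ideal_mpoly_ringD(4)[OF II _ graded_piece_Pol[OF h]]
        by (auto simp: colon_def mult.left_commute[of _ h])
      ultimately have "?c f = ?c (h * f)" using max by blast
      moreover have "g \<in> ?c (h * f)"
        using gh graded_piece_Pol[OF g] by (simp add: colon_def mult.assoc)
      ultimately show "g \<in> ?c f" by simp
    qed
  qed
  with f(2) that show thesis by blast
qed

section \<open>Additivity of the v-number\<close>

text \<open>
  Multiplication by \<open>f1\<close> embeds \<open>K[V]/(I1 : f1)\<close> into \<open>K[V]/I1\<close>, and similarly for \<open>f2\<close>. Over a field the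
  tensor product of two injective maps is injective, and its injectivity is the claim. In
  terms of elements: write \<open>r = \<Sum> a i b i\<close> modulo the sum of the two colons with independent \<open>a i\<close>. The
  \<open>a i f1\<close> are then independent modulo \<open>I1\<close>, which puts every \<open>b i f2\<close> into \<open>I2\<close>.
\<close>

lemma colon_prod_eq_sum_ideal:
  fixes I1 I2 :: "('v, 'k::field) mpoly set"
  assumes disj: "V \<inter> W = {}"
    and I1: "ideal I1 (mpoly_ring V)" and I2: "ideal I2 (mpoly_ring W)"
    and f1: "f1 \<in> Pol V" and f2: "f2 \<in> Pol W"
  shows "colon (mpoly_ring (V \<union> W)) (sum_ideal V W I1 I2) (f1 * f2) =
    sum_ideal V W (colon (mpoly_ring V) I1 f1) (colon (mpoly_ring W) I2 f2)"
    (is "?L = sum_ideal V W ?P1 ?P2")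
proof
  let ?S = "sum_ideal V W I1 I2"
  note P1 = ideal_colon[OF I1 f1] and P2 = ideal_colon[OF I2 f2]
  have prod_mem: "p * (f1 * f2) \<in> ?S" if "p \<in> sum_ideal V W ?P1 ?P2" for p
    using that
  proof (induction rule: sum_ideal.induct)
    case (step a b p)
    then have "(a * f1) * (b * f2) \<in> ?S"
      using f1 f2 by (intro sum_ideal_prod) (auto simp: Pol_mult colon_def)
    from sum_ideal_add[OF this step.IH] show ?case by (simp add: algebra_simps)
  qed (simp add: sum_ideal.zero)
  then show "sum_ideal V W ?P1 ?P2 \<subseteq> ?L"
    using ideal_mpoly_ringD(1)[OF ideal_sum_ideal[OF disj P1 P2]] by (auto simp: colon_def)
  show "?L \<subseteq> sum_ideal V W ?P1 ?P2"
  proof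
    fix r assume "r \<in> ?L"
    then have r: "r \<in> Pol (V \<union> W)" "r * (f1 * f2) \<in> ?S" by (auto simp: colon_def)
    obtain F :: "('v \<Rightarrow>\<^sub>0 nat) set" and a b where F: "finite F"
      and a: "\<And>i. i \<in> F \<Longrightarrow> a i \<in> Pol V" and b: "\<And>i. i \<in> F \<Longrightarrow> b i \<in> Pol W"
      and rep: "r - (\<Sum>i\<in>F. a i * b i) \<in> sum_ideal V W ?P1 ?P2"
      and indep: "indep_mod ?P1 F a" "indep_mod ?P2 F b"
      using independent_representation[OF disj P1 P2 r(1)] by blast
    have "r * (f1 * f2) - (r - (\<Sum>i\<in>F. a i * b i)) * (f1 * f2) \<in> ?S"
      using ideal_mpoly_ring_diff[OF ideal_sum_ideal[OF disj I1 I2] r(2) prod_mem[OF rep]] .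
    then have mem: "(\<Sum>i\<in>F. (a i * f1) * (b i * f2)) \<in> ?S"
      by (simp add: algebra_simps sum_distrib_left sum_distrib_right)
    have "indep_mod I1 F (\<lambda>i. a i * f1)"
      unfolding indep_mod_def
    proof (intro allI impI)
      fix c assume "(\<Sum>i\<in>F. const_mult (c i) (a i * f1)) \<in> I1"
      then have "(\<Sum>i\<in>F. const_mult (c i) (a i)) \<in> ?P1"
        using a by (simp add: colon_def Pol_sum Pol_mult sum_distrib_right mult.assoc)
      with indep(1) show "\<forall>i\<in>F. c i = 0" by (simp add: indep_mod_def)
    qed
    from sum_ideal_coeff_mem[OF disj I1 I2 F _ _ this mem]
    have "b i \<in> ?P2" if "i \<in> F" for i
      using that a b f1 f2 by (simp add: colon_def Pol_mult)
    then have "(\<Sum>i\<in>F. a i * b i) \<in> sum_ideal V W ?P1 ?P2"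
      using a b by (intro sum_ideal_sum sum_ideal_prod) auto
    from sum_ideal_add[OF rep this] show "r \<in> sum_ideal V W ?P1 ?P2" by simp
  qed
qed

text \<open>
  The point is that \<open>f \<notin> P\<close>: otherwise \<open>f\<^sup>2 \<in> P f \<subseteq> I\<close>, hence \<open>f \<in> I\<close>. Then \<open>r f \<in> I \<subseteq> P\<close> implies \<open>r \<in> P\<close>.
\<close>

lemma colon_eq_of_radical:
  assumes rad: "radical_ideal (mpoly_ring V) I"
    and P: "primeideal P (mpoly_ring V)" "I \<subseteq> P"
    and f: "f \<in> Pol V" "f \<notin> I" and kill: "\<And>p. p \<in> P \<Longrightarrow> p * f \<in> I"
  shows "colon (mpoly_ring V) I f = P"
proof
  interpret primeideal P "mpoly_ring V" by (rule P(1))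
  have "f \<notin> P"
  proof
    assume "f \<in> P"
    then have "f ^ 2 \<in> I" using kill by (simp add: power2_eq_square)
    then have "f \<in> radical_of (mpoly_ring V) I"
      using f(1) by (auto simp: radical_of_def intro!: exI[of _ 2])
    with rad f(2) show False by (simp add: radical_ideal_def)
  qed
  then show "colon (mpoly_ring V) I f \<subseteq> P"
    using I_prime[of _ f] f(1) P(2) by (auto simp: colon_def)
  show "P \<subseteq> colon (mpoly_ring V) I f"
    using kill Icarr by (auto simp: colon_def)
qed

text \<open>
  Independence of the \<open>b j\<close> gives \<open>p\<^sub>k a\<^sub>i \<in> I\<close> for every component \<open>p\<^sub>k\<close> of \<open>p\<close>. As \<open>p\<^sub>k\<close> is homogeneous
  and \<open>I\<close> is graded, \<open>p\<^sub>k\<close> times any component of \<open>a\<^sub>i\<close> lies in \<open>I\<close> too; finally sum over \<open>k\<close>. The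
  hypothesis is on the components of \<open>p\<close> because \<open>p\<close> itself may range over an ideal that is not yet
  known to be graded.
\<close>

lemma mult_hom_component_coeff_mem:
  assumes disj: "V \<inter> W = {}" and I: "graded_ideal V I" and J: "graded_ideal W J"
    and F: "finite F" and a: "\<And>i. i \<in> F \<Longrightarrow> a i \<in> Pol V" and b: "\<And>i. i \<in> F \<Longrightarrow> b i \<in> Pol W"
    and indep: "indep_mod J F b" and p: "p \<in> Pol V"
    and mem: "\<And>k. (\<Sum>j\<in>F. (hom_component k p * a j) * b j) \<in> sum_ideal V W I J"
    and i: "i \<in> F"
  shows "p * hom_component e (a i) \<in> I"
proof -
  note II = graded_idealD(1)[OF I] and JI = graded_idealD(1)[OF J]
  have "hom_component k p * hom_component e (a i) \<in> I" for k
  proof -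
    let ?q = "hom_component k p"
    have "(\<Sum>j\<in>F. b j * (?q * a j)) \<in> sum_ideal W V J I"
      using mem[of k] by (simp add: mult.commute[of "b _"] sum_ideal_commute[of W])
    then have "?q * a i \<in> I"
      using sum_ideal_coeff_mem[OF _ JI II F b _ indep _ i, of "\<lambda>j. ?q * a j"] disj a
      by (auto simp: Pol_mult hom_component_Pol p)
    then have "hom_component (k + e) (a i * ?q) \<in> I"
      using graded_idealD(2)[OF I] by (simp add: mult.commute)
    then show ?thesis
      using hom_component_mult_graded_piece[OF a[OF i] hom_component_graded_piece[OF p], of "k + e" k]
      by (simp add: mult.commute)
  qed
  then have "(\<Sum>k\<in>mono_deg ` Poly_Mapping.keys p. hom_component k p * hom_component e (a i)) \<in> I"
    by (intro ideal_mpoly_ring_sum[OF II])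
  then show ?thesis by (simp flip: sum_distrib_right mpoly_eq_sum_hom_component)
qed

text \<open>
  In \<open>A/I1 \<otimes> B/I2\<close>, the elements annihilated by \<open>P1\<close> and by \<open>P2\<close> form the tensor product of the
  annihilators of \<open>P1\<close> in \<open>A/I1\<close> and of \<open>P2\<close> in \<open>B/I2\<close>. A nonzero form among them therefore has a
  nonzero summand that is a product of two forms from these annihilators.
\<close>

lemma homogeneous_factors_of_colon:
  fixes I1 I2 :: "('v, 'k::field) mpoly set"
  assumes disj: "V \<inter> W = {}"
    and I1: "graded_ideal V I1" and I2: "graded_ideal W I2"
    and f: "f \<in> graded_piece (V \<union> W) d" "f \<notin> sum_ideal V W I1 I2"
    and P1: "P1 \<subseteq> Pol V" "\<And>p. p \<in> P1 \<Longrightarrow> p * f \<in> sum_ideal V W I1 I2"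
    and P2: "P2 \<subseteq> Pol W" "\<And>p. p \<in> P2 \<Longrightarrow> p * f \<in> sum_ideal V W I1 I2"
  obtains d1 d2 f1 f2 where "d1 + d2 = d"
    "f1 \<in> graded_piece V d1" "f1 \<notin> I1" "\<And>p. p \<in> P1 \<Longrightarrow> p * f1 \<in> I1"
    "f2 \<in> graded_piece W d2" "f2 \<notin> I2" "\<And>p. p \<in> P2 \<Longrightarrow> p * f2 \<in> I2"
proof -
  let ?S = "sum_ideal V W I1 I2"
  note I1I = graded_idealD(1)[OF I1] and I2I = graded_idealD(1)[OF I2]
  note S = graded_ideal_sum_ideal[OF disj I1 I2]
  note SI = graded_idealD(1)[OF S]
  obtain F :: "('v \<Rightarrow>\<^sub>0 nat) set" and a b where F: "finite F"
    and a: "\<And>i. i \<in> F \<Longrightarrow> a i \<in> Pol V" and b: "\<And>i. i \<in> F \<Longrightarrow> b i \<in> Pol W"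
    and rep: "f - (\<Sum>i\<in>F. a i * b i) \<in> ?S"
    and indep: "indep_mod I1 F a" "indep_mod I2 F b"
    using independent_representation[OF disj I1I I2I graded_piece_Pol[OF f(1)]] by blast
  \<comment> \<open>modulo \<open>S\<close> the form \<open>f\<close> may be replaced by its representation\<close>
  have mult_mem: "(\<Sum>i\<in>F. p * (a i * b i)) \<in> ?S" if p: "p \<in> Pol (V \<union> W)" and pf: "p * f \<in> ?S" for p
  proof -
    have "p * f - p * (f - (\<Sum>i\<in>F. a i * b i)) \<in> ?S"
      using ideal_mpoly_ring_diff[OF SI pf ideal_mpoly_ringD(4)[OF SI rep p]] .
    then show ?thesis by (simp add: algebra_simps sum_distrib_left)
  qed
  \<comment> \<open>\<open>S\<close> is graded and \<open>f\<close> is a form, so \<open>(S : f)\<close> contains the components of its elements\<close>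
  have comp_mult_mem: "hom_component e p * f \<in> ?S" if "p \<in> Pol (V \<union> W)" "p * f \<in> ?S" for p e
    using graded_idealD(2)[OF S that(2), of "e + d"] hom_component_mult_graded_piece[OF that(1) f(1), of "e + d"]
    by simp
  have kill1: "p * hom_component e (a i) \<in> I1" if p: "p \<in> P1" and i: "i \<in> F" for p i e
  proof (rule mult_hom_component_coeff_mem[OF _ I1 I2 F a b indep(2) _ _ i])
    show pV: "p \<in> Pol V" using p P1(1) by blast
    fix k
    have "(\<Sum>j\<in>F. hom_component k p * (a j * b j)) \<in> ?S"
      using P1(2)[OF p] pV
      by (intro mult_mem comp_mult_mem Pol_mono[OF _ hom_component_Pol[OF pV]]) (auto intro: Pol_mono[OF _ pV])
    then show "(\<Sum>j\<in>F. (hom_component k p * a j) * b j) \<in> ?S" by (simp add: mult.assoc)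
  qed (use disj in auto)
  have kill2: "p * hom_component e (b i) \<in> I2" if p: "p \<in> P2" and i: "i \<in> F" for p i e
  proof (rule mult_hom_component_coeff_mem[OF _ I2 I1 F b a indep(1) _ _ i])
    show pW: "p \<in> Pol W" using p P2(1) by blast
    fix k
    have "(\<Sum>j\<in>F. hom_component k p * (a j * b j)) \<in> ?S"
      using P2(2)[OF p] pW
      by (intro mult_mem comp_mult_mem Pol_mono[OF _ hom_component_Pol[OF pW]]) (auto intro: Pol_mono[OF _ pW])
    then show "(\<Sum>j\<in>F. (hom_component k p * b j) * a j) \<in> sum_ideal W V I2 I1"
      by (simp add: ac_simps sum_ideal_commute[of W])
  qed (use disj in auto)
  have "\<exists>i\<in>F. \<exists>e\<le>d. hom_component e (a i) * hom_component (d - e) (b i) \<notin> ?S"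
  proof (rule ccontr)
    assume "\<not> ?thesis"
    \<comment> \<open>otherwise the component of degree \<open>d\<close> of the representation, hence \<open>f\<close> itself, would be in \<open>S\<close>\<close>
    then have "hom_component d (\<Sum>i\<in>F. a i * b i) \<in> ?S"
      unfolding hom_component_sum hom_component_mult by (intro sum_ideal_sum) auto
    moreover have "hom_component d (f - (\<Sum>i\<in>F. a i * b i)) \<in> ?S"
      by (rule graded_idealD(2)[OF S rep])
    ultimately have "hom_component d (f - (\<Sum>i\<in>F. a i * b i) + (\<Sum>i\<in>F. a i * b i)) \<in> ?S"
      unfolding hom_component_add by (rule sum_ideal_add[rotated])
    then show False using f hom_component_of_graded_piece[OF f(1), of d] by simp
  qed
  then obtain i e where i: "i \<in> F" and e: "e \<le> d"
    and notin: "hom_component e (a i) * hom_component (d - e) (b i) \<notin> ?S" by blast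
  have mem: "hom_component e (a i) \<in> graded_piece V e" "hom_component (d - e) (b i) \<in> graded_piece W (d - e)"
    using a[OF i] b[OF i] by (simp_all add: hom_component_graded_piece)
  then have "hom_component e (a i) \<notin> I1" "hom_component (d - e) (b i) \<notin> I2"
    using notin sum_ideal_prod graded_piece_Pol by blast+
  with that[of e "d - e"] e mem kill1 kill2 i show thesis by auto
qed

lemma v_number_eq_Least:
  assumes I: "ideal I (mpoly_ring V)"
  shows "v_number V I =
    (LEAST d. \<exists>f\<in>graded_piece V d. primeideal (colon (mpoly_ring V) I f) (mpoly_ring V))"
proof -
  interpret cring "mpoly_ring V" by (rule cring_mpoly_ring)
  have "(\<exists>P\<in>ass_primes (mpoly_ring V) I. colon (mpoly_ring V) I f = P) \<longleftrightarrow>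
      primeideal (colon (mpoly_ring V) I f) (mpoly_ring V)" if "f \<in> graded_piece V d" for f d
    using graded_piece_Pol[OF that] by (auto simp: ass_primes_iff_colon[OF I])
  then show ?thesis unfolding v_number_def by (metis (no_types, lifting))
qed

theorem theorem3p11:
  fixes V W :: "'v set"
    and I1 I2 :: "('v, 'k::field) mpoly set"
  assumes "finite V" and "finite W" and "V \<inter> W = {}"
    and "graded_ideal V I1" and "I1 \<noteq> carrier (mpoly_ring V)"
    and "radical_ideal (mpoly_ring V) I1"
    and "graded_ideal W I2" and "I2 \<noteq> carrier (mpoly_ring W)"
    and "radical_ideal (mpoly_ring W) I2"
    and "radical_ideal (mpoly_ring (V \<union> W)) (ext_sum (mpoly_ring (V \<union> W)) I1 I2)"
    and "ass_primes (mpoly_ring (V \<union> W)) (ext_sum (mpoly_ring (V \<union> W)) I1 I2) =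
           {ext_sum (mpoly_ring (V \<union> W)) P1 P2 | P1 P2.
              P1 \<in> ass_primes (mpoly_ring V) I1 \<and> P2 \<in> ass_primes (mpoly_ring W) I2}"
  shows "v_number (V \<union> W) (ext_sum (mpoly_ring (V \<union> W)) I1 I2) = v_number V I1 + v_number W I2"
proof -
  let ?A = "mpoly_ring V :: ('v, 'k) mpoly ring" and ?B = "mpoly_ring W :: ('v, 'k) mpoly ring"
    and ?R = "mpoly_ring (V \<union> W) :: ('v, 'k) mpoly ring"
  let ?S = "sum_ideal V W I1 I2"
  interpret A: cring ?A by (rule cring_mpoly_ring)
  interpret B: cring ?B by (rule cring_mpoly_ring)
  interpret R: cring ?R by (rule cring_mpoly_ring)
  note disj = \<open>V \<inter> W = {}\<close>
  note I1 = graded_idealD(1)[OF \<open>graded_ideal V I1\<close>] and I2 = graded_idealD(1)[OF \<open>graded_ideal W I2\<close>]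
  note S = ideal_sum_ideal[OF disj I1 I2]
  have ext: "ext_sum ?R I1 I2 = ?S" by (rule ext_sum_eq_sum_ideal[OF disj I1 I2])
  note ass1 = A.ass_primes_iff_colon[OF I1] and ass2 = B.ass_primes_iff_colon[OF I2]
    and assS = R.ass_primes_iff_colon[OF S]
  have ass_sum: "Q \<in> ass_primes ?R ?S \<longleftrightarrow>
      (\<exists>P1 P2. P1 \<in> ass_primes ?A I1 \<and> P2 \<in> ass_primes ?B I2 \<and> Q = sum_ideal V W P1 P2)" for Q
  proof -
    have "ext_sum ?R P1 P2 = sum_ideal V W P1 P2"
      if "P1 \<in> ass_primes ?A I1" "P2 \<in> ass_primes ?B I2" for P1 P2
      using ext_sum_eq_sum_ideal[OF disj] that unfolding ass1 ass2
      by (auto dest: primeideal.axioms(1))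
    moreover have "Q \<in> ass_primes ?R ?S \<longleftrightarrow>
        (\<exists>P1 P2. Q = ext_sum ?R P1 P2 \<and> P1 \<in> ass_primes ?A I1 \<and> P2 \<in> ass_primes ?B I2)"
      using assms(11) unfolding ext by simp
    ultimately show ?thesis by metis
  qed
  have v_le: "v_number U I \<le> d"
    if "ideal I (mpoly_ring U)" "f \<in> graded_piece U d" "primeideal (colon (mpoly_ring U) I f) (mpoly_ring U)"
    for U and I :: "('v, 'k) mpoly set" and f d
    unfolding v_number_eq_Least[OF that(1)] using that(2,3) by (intro Least_le) blast
  have v_attained: "\<exists>f\<in>graded_piece U (v_number U I). primeideal (colon (mpoly_ring U) I f) (mpoly_ring U)"
    if "ideal I (mpoly_ring U)" "f \<in> graded_piece U d" "primeideal (colon (mpoly_ring U) I f) (mpoly_ring U)"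
    for U and I :: "('v, 'k) mpoly set" and f d
    unfolding v_number_eq_Least[OF that(1)] by (rule LeastI_ex) (use that(2,3) in blast)

  \<comment> \<open>upper bound: a product of optimal elements\<close>
  obtain f1 where f1: "f1 \<in> graded_piece V (v_number V I1)" "primeideal (colon ?A I1 f1) ?A"
    using exists_homogeneous_prime_colon[OF assms(1,4,5)] v_attained[OF I1] by metis
  obtain f2 where f2: "f2 \<in> graded_piece W (v_number W I2)" "primeideal (colon ?B I2 f2) ?B"
    using exists_homogeneous_prime_colon[OF assms(2,7,8)] v_attained[OF I2] by metis
  have f12: "f1 * f2 \<in> graded_piece (V \<union> W) (v_number V I1 + v_number W I2)"
    by (rule graded_piece_mult[OF graded_piece_mono[OF _ f1(1)] graded_piece_mono[OF _ f2(1)]]) auto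
  have "colon ?A I1 f1 \<in> ass_primes ?A I1" "colon ?B I2 f2 \<in> ass_primes ?B I2"
    using f1 f2 graded_piece_Pol unfolding ass1 ass2 by blast+
  then have "colon ?R ?S (f1 * f2) \<in> ass_primes ?R ?S"
    unfolding colon_prod_eq_sum_ideal[OF disj I1 I2 graded_piece_Pol[OF f1(1)] graded_piece_Pol[OF f2(1)]]
      ass_sum by blast
  then have prime12: "primeideal (colon ?R ?S (f1 * f2)) ?R" unfolding assS by blast
  have upper: "v_number (V \<union> W) ?S \<le> v_number V I1 + v_number W I2"
    by (rule v_le[OF S f12 prime12])

  \<comment> \<open>lower bound: an optimal element for \<open>S\<close> yields factors whose colons are \<open>P1\<close> and \<open>P2\<close>\<close>
  obtain f where f: "f \<in> graded_piece (V \<union> W) (v_number (V \<union> W) ?S)" "primeideal (colon ?R ?S f) ?R"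
    using v_attained[OF S f12 prime12] by blast
  have "colon ?R ?S f \<in> ass_primes ?R ?S"
    using f graded_piece_Pol unfolding assS by blast
  then obtain P1 P2 where P1: "P1 \<in> ass_primes ?A I1" and P2: "P2 \<in> ass_primes ?B I2"
    and colon: "colon ?R ?S f = sum_ideal V W P1 P2"
    unfolding ass_sum by blast
  obtain u1 where u1: "u1 \<in> Pol V" "P1 = colon ?A I1 u1" and prime1: "primeideal P1 ?A"
    using P1 unfolding ass1 by blast
  obtain u2 where u2: "u2 \<in> Pol W" "P2 = colon ?B I2 u2" and prime2: "primeideal P2 ?B"
    using P2 unfolding ass2 by blast
  have P1_sub: "P1 \<subseteq> Pol V" "I1 \<subseteq> P1" and P2_sub: "P2 \<subseteq> Pol W" "I2 \<subseteq> P2"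
    using u1 u2 ideal_mpoly_ringD(1,5)[OF I1] ideal_mpoly_ringD(1,5)[OF I2] by (auto simp: colon_def)
  have kill1: "p * f \<in> ?S" if "p \<in> P1" for p
  proof -
    have "p * 1 \<in> sum_ideal V W P1 P2" using that P1_sub by (intro sum_ideal_prod) auto
    then show ?thesis unfolding colon[symmetric] by (simp add: colon_def)
  qed
  have kill2: "p * f \<in> ?S" if "p \<in> P2" for p
  proof -
    have "1 * p \<in> sum_ideal V W P1 P2" using that P2_sub by (intro sum_ideal_prod) auto
    then show ?thesis unfolding colon[symmetric] by (simp add: colon_def)
  qed
  have "f \<notin> ?S"
  proof
    assume "f \<in> ?S"
    then have "colon ?R ?S f = Pol (V \<union> W)"
      using ideal_mpoly_ringD(4)[OF S] by (auto simp: colon_def)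
    with primeideal.I_notcarr[OF f(2)] show False by simp
  qed
  then obtain d1 d2 g1 g2 where d: "d1 + d2 = v_number (V \<union> W) ?S"
    and g1: "g1 \<in> graded_piece V d1" "g1 \<notin> I1" "\<And>p. p \<in> P1 \<Longrightarrow> p * g1 \<in> I1"
    and g2: "g2 \<in> graded_piece W d2" "g2 \<notin> I2" "\<And>p. p \<in> P2 \<Longrightarrow> p * g2 \<in> I2"
    using homogeneous_factors_of_colon[OF disj assms(4,7) f(1) _ P1_sub(1) kill1 P2_sub(1) kill2] by metis
  have "colon ?A I1 g1 = P1" "colon ?B I2 g2 = P2"
    using colon_eq_of_radical[OF assms(6) prime1 P1_sub(2) graded_piece_Pol[OF g1(1)] g1(2,3)]
      colon_eq_of_radical[OF assms(9) prime2 P2_sub(2) graded_piece_Pol[OF g2(1)] g2(2,3)] by auto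
  then have "v_number V I1 \<le> d1" "v_number W I2 \<le> d2"
    using v_le[OF I1 g1(1)] v_le[OF I2 g2(1)] prime1 prime2 by auto
  with upper d show ?thesis unfolding ext by simp
qed

end
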